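(* Let $\xi^{\circ}\sim \mathrm{GD}(\lambda,P^{\circ})$, let $\Lambda(s):=\int_s^{\infty}\lambda(u)\,du$ for $s>0$, and let $\Lambda^{-}(s):=\inf\{t>0 : \Lambda(t)\leq s\}$ be its right-continuous inverse. Let $E_1,E_2,\ldots$ be i.i.d. exponential variables with mean $1$. Then for any $a>0$, $$(\Delta_2,\Delta_3,\ldots)\,\big|\,\Delta^{\circ}=a \quad\stackrel{d}{=}\quad (M^{(a)}_2,M^{(a)}_3,\ldots),$$ where $M^{(a)}_k:=\Lambda^{-}\bigl(\Lambda(a)+E_2+\ldots+E_k\bigr)$ for every $k\geq 2$.
   Context: $\lambda$ is a continuous Lévy density on $(0,\infty)$: $\lambda\ge 0$, $\int_0^\infty \min(1,s)\lambda(s)\,ds<\infty$, with $\int_0^\infty\lambda(s)\,ds=\infty$ so that there are infinitely many jumps. $\Delta_1>\Delta_2>\cdots$ are the jumps, ranked in decreasing order, of a subordinator with Lévy density $\lambda$, i.e. the ranked points of a Poisson process on $(0,\infty)$ with intensity $\lambda(s)\,ds$. Let $U_1,U_2,\ldots$ be i.i.d. random elements of a space $\mathbb{U}$, independent of $(\Delta_k)$, and $\xi:=\sum_{k\ge1}\frac{\Delta_{k+1}}{\Delta_1}\delta_{U_k}$. Conditionally on $\Delta_1=a$, the sequence $(\Delta_2,\Delta_3,\ldots)$ is (for the version of the conditional law used here) the ranked sequence of jumps of a subordinator with Lévy density $\lambda(s)\mathbb{I}\{s\le a\}$. For $a>0$ let $\xi_a:=\xi\,|\,(\Delta_1=a)$.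 Let $P^\circ$ be a probability measure on $(0,\infty)$ and $\Delta^\circ\sim P^\circ$. The random measure $\xi^\circ:=\xi_{\Delta^\circ}=\xi\,|\,(\Delta_1=\Delta^\circ)$ (given $\Delta^\circ=a$ it is distributed as $\xi_a$) has law denoted $\mathrm{GD}(\lambda,P^\circ)$. The notation $(\Delta_2,\Delta_3,\ldots)\,|\,\Delta^\circ=a$ means the sequence $(\Delta_2,\Delta_3,\ldots)$ underlying $\xi^\circ$ conditionally on $\Delta^\circ=a$, i.e. with the law of $(\Delta_2,\Delta_3,\ldots)$ given $\Delta_1=a$. *)

theory Defs
  imports "HOL-Probability.Probability"
begin

definition levy_measure :: "(real \<Rightarrow> real) \<Rightarrow> real measure" where
  "levy_measure lam = density lborel (\<lambda>s. ennreal (lam s) * indicator {0<..} s)"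

definition continuous_levy_density :: "(real \<Rightarrow> real) \<Rightarrow> bool" where
  "continuous_levy_density lam \<longleftrightarrow>
     continuous_on {0<..} lam \<and> (\<forall>s>0. 0 \<le> lam s) \<and>
     (\<integral>\<^sup>+s\<in>{0<..}. ennreal (min 1 s * lam s) \<partial>lborel) < \<infinity> \<and>
     (\<integral>\<^sup>+s\<in>{0<..}. ennreal (lam s) \<partial>lborel) = \<infinity>"

definition truncated_density :: "(real \<Rightarrow> real) \<Rightarrow> real \<Rightarrow> real \<Rightarrow> real" where
  "truncated_density lam a s = lam s * indicator {..a} s"

text \<open>The rate may be \<open>0\<close> (unit mass at \<open>0\<close>, since \<open>0 ^ 0 = 1\<close>) or \<open>\<infinity>\<close> (unit mass at \<open>\<infinity>\<close>);
  \<^const>\<open>poisson_pmf\<close> covers only positive finite rates.\<close>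

definition poisson_distributed :: "'w measure \<Rightarrow> ('w \<Rightarrow> ennreal) \<Rightarrow> ennreal \<Rightarrow> bool" where
  "poisson_distributed M Y m \<longleftrightarrow> Y \<in> borel_measurable M \<and>
     (if m = \<infinity> then AE \<omega> in M. Y \<omega> = \<infinity>
      else \<forall>n::nat. measure M {\<omega> \<in> space M. Y \<omega> = of_nat n} =
             exp (- enn2real m) * enn2real m ^ n / fact n)"

text \<open>Poisson process, viewed as a random counting measure \<open>N\<close>, with intensity measure \<open>\<mu>\<close>.
  Finite disjoint families are included: pad with empty sets.\<close>

definition poisson_process :: "'w measure \<Rightarrow> 's measure \<Rightarrow> ('w \<Rightarrow> 's measure) \<Rightarrow> bool" where
  "poisson_process M \<mu> N \<longleftrightarrow>
     (\<forall>B\<in>sets \<mu>. poisson_distributed M (\<lambda>\<omega>. emeasure (N \<omega>) B) (emeasure \<mu> B)) \<and>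
     (\<forall>A::nat \<Rightarrow> 's set. range A \<subseteq> sets \<mu> \<longrightarrow> disjoint_family A \<longrightarrow>
        prob_space.indep_vars M (\<lambda>_. borel) (\<lambda>n \<omega>. emeasure (N \<omega>) (A n)) UNIV)"

text \<open>\<open>X k\<close>, for \<open>k \<in> I\<close>, are all the jumps, ranked in decreasing order, of a subordinator with
  Levy density \<open>lam\<close>. The random measure below is the sum of the Dirac masses at the \<open>X k\<close>.\<close>

definition ranked_jumps ::
    "'w measure \<Rightarrow> nat set \<Rightarrow> (real \<Rightarrow> real) \<Rightarrow> (nat \<Rightarrow> 'w \<Rightarrow> real) \<Rightarrow> bool" where
  "ranked_jumps M I lam X \<longleftrightarrow> prob_space M \<and>
     (\<forall>k\<in>I. X k \<in> borel_measurable M) \<and>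
     (AE \<omega> in M. \<forall>k\<in>I. 0 < X k \<omega>) \<and>
     (AE \<omega> in M. \<forall>j\<in>I. \<forall>k\<in>I. j < k \<longrightarrow> X k \<omega> < X j \<omega>) \<and>
     poisson_process M (levy_measure lam) (\<lambda>\<omega>. distr (count_space I) borel (\<lambda>k. X k \<omega>))"

abbreviation tail_space :: "(nat \<Rightarrow> real) measure" where
  "tail_space \<equiv> Pi\<^sub>M {2..} (\<lambda>_. borel)"

definition tail_seq :: "(nat \<Rightarrow> 'w \<Rightarrow> real) \<Rightarrow> 'w \<Rightarrow> nat \<Rightarrow> real" where
  "tail_seq X \<omega> = (\<lambda>k\<in>{2..}. X k \<omega>)"

text \<open>\<open>K y\<close> is a version of the law of \<open>X\<close> given \<open>Y = y\<close>.\<close>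

definition regular_conditional_law ::
    "'w measure \<Rightarrow> 'x measure \<Rightarrow> ('w \<Rightarrow> 'x) \<Rightarrow> 'y measure \<Rightarrow> ('w \<Rightarrow> 'y) \<Rightarrow> ('y \<Rightarrow> 'x measure) \<Rightarrow> bool"
  where
  "regular_conditional_law M T X S Y K \<longleftrightarrow>
     X \<in> M \<rightarrow>\<^sub>M T \<and> Y \<in> M \<rightarrow>\<^sub>M S \<and> K \<in> S \<rightarrow>\<^sub>M prob_algebra T \<and>
     (\<forall>A\<in>sets S. \<forall>B\<in>sets T.
        emeasure M {\<omega> \<in> space M. Y \<omega> \<in> A \<and> X \<omega> \<in> B} =
          (\<integral>\<^sup>+y\<in>A. emeasure (K y) B \<partial>distr M S Y))"

text \<open>The conditional law of the smaller jumps given the largest one is determined only up to null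
  sets of values of the latter; the second conjunct fixes the version at every \<open>a > 0\<close>.\<close>

definition tail_law_given_first ::
    "'w measure \<Rightarrow> (real \<Rightarrow> real) \<Rightarrow> (nat \<Rightarrow> 'w \<Rightarrow> real) \<Rightarrow> (real \<Rightarrow> (nat \<Rightarrow> real) measure) \<Rightarrow> bool"
  where
  "tail_law_given_first M lam \<Delta> K \<longleftrightarrow>
     regular_conditional_law M tail_space (tail_seq \<Delta>) borel (\<Delta> 1) K \<and>
     (\<forall>a>0. ranked_jumps (K a) {2..} (truncated_density lam a) (\<lambda>k x. x k))"

text \<open>\<open>xi\<close> is the random measure \<open>\<Sum>k\<ge>1. (D (k + 1) / D1) \<delta>_{U k}\<close>, with \<open>U\<close> i.i.d. of law \<open>H\<close>
  and independent of \<open>(D1, D 2, D 3, \<dots>)\<close>; the values \<open>D 0\<close> and \<open>D 1\<close> are not used.\<close>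

definition normalized_random_measure ::
    "'w measure \<Rightarrow> 'u measure \<Rightarrow> ('w \<Rightarrow> real) \<Rightarrow> (nat \<Rightarrow> 'w \<Rightarrow> real) \<Rightarrow> (nat \<Rightarrow> 'w \<Rightarrow> 'u) \<Rightarrow>
     ('w \<Rightarrow> 'u measure) \<Rightarrow> bool" where
  "normalized_random_measure M H D1 D U xi \<longleftrightarrow> prob_space M \<and> prob_space H \<and>
     (\<forall>k\<ge>1. U k \<in> M \<rightarrow>\<^sub>M H \<and> distr M H (U k) = H) \<and>
     prob_space.indep_vars M (\<lambda>_. H) U {1..} \<and>
     prob_space.indep_set M
       (sets (vimage_algebra (space M) (\<lambda>\<omega>. (D1 \<omega>, tail_seq D \<omega>)) (borel \<Otimes>\<^sub>M tail_space)))
       (sets (vimage_algebra (space M) (\<lambda>\<omega>. \<lambda>k\<in>{1..}. U k \<omega>) (Pi\<^sub>M {1..} (\<lambda>_. H)))) \<and>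
     (\<forall>\<omega>\<in>space M. xi \<omega> =
        distr (point_measure {1..} (\<lambda>k. ennreal (D (k + 1) \<omega> / D1 \<omega>))) H (\<lambda>k. U k \<omega>))"

text \<open>\<open>xi\<close> has law \<open>GD(\<lambda>, P0)\<close>, where \<open>K a\<close> is the law of the smaller jumps given that the largest
  is \<open>a\<close>. The underlying variables are kept explicit, because the sequence \<open>D\<close> cannot in general be
  read off from the law of \<open>xi\<close>.\<close>

definition GD_distributed ::
    "'w measure \<Rightarrow> (real \<Rightarrow> (nat \<Rightarrow> real) measure) \<Rightarrow> real measure \<Rightarrow> 'u measure \<Rightarrow>
     ('w \<Rightarrow> real) \<Rightarrow> (nat \<Rightarrow> 'w \<Rightarrow> real) \<Rightarrow> (nat \<Rightarrow> 'w \<Rightarrow> 'u) \<Rightarrow> ('w \<Rightarrow> 'u measure) \<Rightarrow> bool" where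
  "GD_distributed M K P0 H D0 D U xi \<longleftrightarrow>
     D0 \<in> borel_measurable M \<and> distr M borel D0 = P0 \<and>
     regular_conditional_law M tail_space (tail_seq D) borel D0 K \<and>
     normalized_random_measure M H D0 D U xi"

definition levy_tail :: "(real \<Rightarrow> real) \<Rightarrow> real \<Rightarrow> real" where
  "levy_tail lam s = (LBINT u:{s<..}. lam u)"

text \<open>For \<open>s > 0\<close> and a Levy density of infinite mass, the set is nonempty with positive infimum.\<close>

definition levy_tail_inverse :: "(real \<Rightarrow> real) \<Rightarrow> real \<Rightarrow> real" where
  "levy_tail_inverse lam s = Inf {t. t > 0 \<and> levy_tail lam t \<le> s}"

definition M_seq :: "(real \<Rightarrow> real) \<Rightarrow> (nat \<Rightarrow> 'w \<Rightarrow> real) \<Rightarrow> real \<Rightarrow> nat \<Rightarrow> 'w \<Rightarrow> real" where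
  "M_seq lam E a k \<omega> = levy_tail_inverse lam (levy_tail lam a + (\<Sum>i=2..k. E i \<omega>))"

end

theory Submission
  imports Defs
begin

text \<open>The map \<open>x \<mapsto> \<Lambda>(x) - \<Lambda>(a)\<close> turns the jumps below \<open>a\<close>, read in decreasing order, into the
  arrival times of a Poisson process of unit rate, and almost surely no jump is lost, because jumps
  avoid the zeros of \<open>\<lambda>\<close> and \<open>\<Lambda>\<^sup>-\<close> inverts \<open>\<Lambda>\<close> off these zeros. It remains to see that the arrival
  times of a unit rate process are distributed as partial sums of i.i.d. exponentials. Both sequences
  give the event that the \<open>i\<close>-th arrival lies in \<open>(\<alpha> i, \<beta> i]\<close> for \<open>i < n\<close> and the \<open>n\<close>-th one after
  \<open>\<alpha> n\<close>, where \<open>0 \<le> \<alpha> 0 \<le> \<beta> 0 \<le> \<alpha> 1 \<le> \<dots> \<le> \<alpha> n\<close>, the probability \<open>exp (- \<alpha> n) * (\<Prod>i<n. \<beta> i - \<alpha> i)\<close>,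
  and on positive increasing sequences these events form a generating \<open>\<pi>\<close>-system.\<close>

subsection \<open>The tail of a Levy density and its inverse\<close>

text \<open>Continuity is given on the positive half line and \<open>lam\<close> is arbitrary
  elsewhere, so measurability is stated for the product with the indicator.\<close>

lemma levy_density_measurable:
  assumes "continuous_levy_density lam"
  shows "(\<lambda>s. indicator {0<..} s * lam s) \<in> borel_measurable borel"
  using assms borel_measurable_continuous_on_indicator[of "{0<..}" lam]
  by (simp add: continuous_levy_density_def)

lemma levy_density_set_integrable:
  assumes lam: "continuous_levy_density lam" and "0 < s"
  shows "set_integrable lborel {s<..} lam"
proof -
  have m: "(\<lambda>u. indicator {s<..} u *\<^sub>R lam u) \<in> borel_measurable lborel"
  proof -
    have "(\<lambda>u. indicator {s<..} u * (indicator {0<..} u * lam u)) \<in> borel_measurable borel"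
      using levy_density_measurable[OF lam] by measurable
    also have "(\<lambda>u. indicator {s<..} u * (indicator {0<..} u * lam u)) = (\<lambda>u. indicator {s<..} u *\<^sub>R lam u)"
      using \<open>0 < s\<close> by (auto split: split_indicator)
    finally show ?thesis by simp
  qed
  \<comment> \<open>For \<open>u > s\<close> the weight \<open>min 1 u\<close> is at least
    \<open>min 1 s\<close>, so \<open>c * min 1 u \<ge> 1\<close> and the finite integral of
    \<open>min 1 u * lam u\<close> dominates that of \<open>lam\<close>.\<close>
  define c where "c = 1 / min 1 s"
  have c: "0 < c" using \<open>0 < s\<close> by (simp add: c_def)
  have "(\<integral>\<^sup>+u. ennreal (norm (indicator {s<..} u *\<^sub>R lam u)) \<partial>lborel)
      \<le> (\<integral>\<^sup>+u. ennreal c * (ennreal (min 1 u * lam u) * indicator {0<..} u) \<partial>lborel)"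
  proof (intro nn_integral_mono)
    fix u :: real
    show "ennreal (norm (indicator {s<..} u *\<^sub>R lam u))
        \<le> ennreal c * (ennreal (min 1 u * lam u) * indicator {0<..} u)"
    proof (cases "s < u")
      case True
      have l: "0 \<le> lam u" using lam True \<open>0 < s\<close> by (auto simp: continuous_levy_density_def)
      have "1 \<le> c * min 1 u" using True \<open>0 < s\<close> by (auto simp: c_def field_simps)
      hence "lam u \<le> c * min 1 u * lam u" using l by (metis mult_1 mult_right_mono)
      with True \<open>0 < s\<close> l c show ?thesis
        by (auto simp: ennreal_mult'[symmetric] mult.assoc intro!: ennreal_leI)
    qed auto
  qed
  also have "\<dots> = ennreal c * (\<integral>\<^sup>+u\<in>{0<..}. ennreal (min 1 u * lam u) \<partial>lborel)"
  proof (rule nn_integral_cmult)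
    have "(\<lambda>u. ennreal (min 1 u * (indicator {0<..} u * lam u))) \<in> borel_measurable lborel"
      using levy_density_measurable[OF lam] by measurable
    also have "(\<lambda>u. ennreal (min 1 u * (indicator {0<..} u * lam u)))
        = (\<lambda>u. ennreal (min 1 u * lam u) * indicator {0<..} u)"
      by (auto split: split_indicator)
    finally show "(\<lambda>u. ennreal (min 1 u * lam u) * indicator {0<..} u) \<in> borel_measurable lborel" .
  qed
  also have "\<dots> < \<infinity>"
    using lam by (auto simp: continuous_levy_density_def ennreal_mult_less_top)
  finally show ?thesis
    unfolding set_integrable_def using m by (simp add: integrable_iff_bounded)
qed

text \<open>The Lebesgue form serves to compute Levy measures of intervals; the form over the closed
  interval, with its continuous integrand, serves for monotonicity and continuity of the
  tail.\<close>

lemma levy_tail_diff: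
  assumes lam: "continuous_levy_density lam" and "0 < s" "s \<le> t"
  shows "levy_tail lam s - levy_tail lam t = (LBINT u:{s<..t}. lam u)"
    and "levy_tail lam s - levy_tail lam t = integral {s..t} lam"
proof -
  have i: "set_integrable lborel {s<..t} lam"
    by (rule set_integrable_subset[OF levy_density_set_integrable[OF lam \<open>0 < s\<close>]]) auto
  have "levy_tail lam s = (LBINT u:{s<..t} \<union> {t<..}. lam u)"
    using \<open>s \<le> t\<close> by (simp add: levy_tail_def ivl_disj_un_one)
  also have "\<dots> = (LBINT u:{s<..t}. lam u) + levy_tail lam t"
    unfolding levy_tail_def using assms
    by (intro set_integral_Un i levy_density_set_integrable[OF lam]) auto
  finally show d: "levy_tail lam s - levy_tail lam t = (LBINT u:{s<..t}. lam u)" by simp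
  also have "\<dots> = integral {s<..t} lam"
    by (rule set_borel_integral_eq_integral[OF i])
  also have "\<dots> = integral {s..t} lam"
    by (intro integral_spike_set negligible_subset[OF negligible_sing[of s]]) auto
  finally show "levy_tail lam s - levy_tail lam t = integral {s..t} lam" .
qed

lemma levy_density_continuous_on:
  assumes "continuous_levy_density lam" and "0 < s"
  shows "continuous_on {s..t} lam"
  using assms by (auto simp: continuous_levy_density_def intro: continuous_on_subset)

lemma levy_tail_antimono:
  assumes lam: "continuous_levy_density lam" and "0 < s" "s \<le> t"
  shows "levy_tail lam t \<le> levy_tail lam s"
proof -
  have "0 \<le> integral {s..t} lam"
    using assms by (intro integral_nonneg integrable_continuous_real levy_density_continuous_on)
      (auto simp: continuous_levy_density_def)
  thus ?thesis using levy_tail_diff(2)[OF assms] by simp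
qed

text \<open>A nonnegative continuous function with zero integral over a nondegenerate interval
  vanishes on all of it, endpoints included. Later \<open>x\<close> is always an endpoint, mostly
  the position of a jump.\<close>

lemma levy_tail_strict_antimono:
  assumes lam: "continuous_levy_density lam" and st: "0 < s" "s < t"
    and x: "s \<le> x" "x \<le> t" "lam x \<noteq> 0"
  shows "levy_tail lam t < levy_tail lam s"
proof -
  have "integral {s..t} lam \<noteq> 0"
  proof
    assume "integral {s..t} lam = 0"
    hence "\<forall>u\<in>{s..t}. lam u = 0"
      using lam st integral_eq_0_iff[of s t lam]
      by (auto simp: levy_density_continuous_on continuous_levy_density_def)
    thus False using x by auto
  qed
  thus ?thesis
    using levy_tail_diff(2)[OF lam, of s t] levy_tail_antimono[OF lam, of s t] st by auto
qed

lemma isCont_levy_tail: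
  assumes lam: "continuous_levy_density lam" and "0 < x"
  shows "isCont (levy_tail lam) x"
proof -
  \<comment> \<open>The base point \<open>x/2\<close> stays away from 0, where the mass is infinite,
    and leaves \<open>x\<close> in the interior of the interval.\<close>
  have "continuous_on {x/2..x+1} (\<lambda>t. levy_tail lam (x/2) - integral {x/2..t} lam)"
    using assms
    by (intro continuous_intros indefinite_integral_continuous_1 integrable_continuous_real
        levy_density_continuous_on) auto
  moreover have "levy_tail lam (x/2) - integral {x/2..t} lam = levy_tail lam t"
    if "t \<in> {x/2..x+1}" for t
    using levy_tail_diff(2)[OF lam, of "x/2" t] that \<open>0 < x\<close> by auto
  ultimately have "continuous_on {x/2..x+1} (levy_tail lam)"
    by (rule continuous_on_eq)
  thus ?thesis
    using \<open>0 < x\<close> by (intro continuous_on_interior) (auto simp: interior_atLeastAtMost_real)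
qed

text \<open>The sets \<open>?A n\<close> increase to the positive half line, so by continuity from
  below a common bound on the tails would bound the total mass, which is infinite.\<close>

lemma levy_tail_unbounded:
  assumes lam: "continuous_levy_density lam"
  shows "\<exists>t>0. s < levy_tail lam t"
proof (rule ccontr)
  assume "\<not> ?thesis"
  hence bd: "levy_tail lam t \<le> s" if "0 < t" for t using that by (meson not_less)
  let ?A = "\<lambda>n::nat. {inverse (Suc n)<..} :: real set"
  let ?f = "\<lambda>u::real. indicator {0<..} u * lam u"
  have nn: "0 \<le> ?f u" for u using lam by (auto simp: continuous_levy_density_def split: split_indicator)
  have "\<infinity> = (\<integral>\<^sup>+u\<in>(\<Union>n. ?A n). ennreal (?f u) \<partial>lborel)"
  proof -
    have U: "(\<Union>n. ?A n) = {0<..}"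
      by (auto simp del: of_nat_Suc dest: reals_Archimedean intro: less_trans[rotated])
    have "(\<integral>\<^sup>+u\<in>(\<Union>n. ?A n). ennreal (?f u) \<partial>lborel) = (\<integral>\<^sup>+u\<in>{0<..}. ennreal (lam u) \<partial>lborel)"
      unfolding U by (intro nn_integral_cong) (auto split: split_indicator)
    thus ?thesis using lam by (simp add: continuous_levy_density_def)
  qed
  also have "\<dots> = emeasure (density lborel (\<lambda>u. ennreal (?f u))) (\<Union>n. ?A n)"
    using levy_density_measurable[OF lam] by (subst emeasure_density) auto
  also have "\<dots> = (SUP n. emeasure (density lborel (\<lambda>u. ennreal (?f u))) (?A n))"
  proof (rule SUP_emeasure_incseq[symmetric])
    show "incseq ?A"
      by (intro monoI) (auto intro: le_less_trans[rotated] simp: le_imp_inverse_le)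
  qed auto
  also have "\<dots> \<le> ennreal s"
  proof (rule SUP_least)
    fix n
    have p: "0 < inverse (real (Suc n))" by simp
    have "emeasure (density lborel (\<lambda>u. ennreal (?f u))) (?A n)
        = (\<integral>\<^sup>+u. ennreal (indicator (?A n) u *\<^sub>R lam u) \<partial>lborel)"
      using levy_density_measurable[OF lam]
      by (subst emeasure_density) (auto intro!: nn_integral_cong split: split_indicator
           simp del: of_nat_Suc dest: less_trans[OF p])
    also have "\<dots> = ennreal (levy_tail lam (inverse (Suc n)))"
      unfolding levy_tail_def set_lebesgue_integral_def
      using levy_density_set_integrable[OF lam p] lam less_trans[OF p]
      by (intro nn_integral_eq_integral)
         (auto simp: set_integrable_def continuous_levy_density_def split: split_indicator
           simp del: of_nat_Suc)
    finally show "emeasure (density lborel (\<lambda>u. ennreal (?f u))) (?A n) \<le> ennreal s"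
      using bd[OF p] by (simp add: ennreal_leI)
  qed
  finally show False by (simp add: top.extremum_unique)
qed

text \<open>The point \<open>a\<close> makes the set under the infimum nonempty, unboundedness of
  the tail keeps this set away from 0, and continuity makes it closed, so the infimum is
  attained.\<close>

lemma
  assumes lam: "continuous_levy_density lam" and "0 < a" and s: "levy_tail lam a \<le> s"
  shows levy_tail_inverse_pos: "0 < levy_tail_inverse lam s"
    and levy_tail_levy_tail_inverse: "levy_tail lam (levy_tail_inverse lam s) = s"
    and levy_tail_inverse_le_iff: "0 < x \<Longrightarrow> levy_tail_inverse lam s \<le> x \<longleftrightarrow> levy_tail lam x \<le> s"
proof -
  obtain b where b: "0 < b" "s < levy_tail lam b" using levy_tail_unbounded[OF lam] by auto
  define A where "A = {t. t > 0 \<and> levy_tail lam t \<le> s}"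
  define r where "r = Inf A"
  have r: "levy_tail_inverse lam s = r" by (simp add: levy_tail_inverse_def r_def A_def)
  have aA: "a \<in> A" using assms by (simp add: A_def)
  have Ab: "b < t" if "t \<in> A" for t
    using levy_tail_antimono[OF lam, of t b] that b by (auto simp: A_def not_less[symmetric])
  have cont: "continuous_on {b..} (levy_tail lam)"
    using b isCont_levy_tail[OF lam] by (intro continuous_at_imp_continuous_on) auto
  \<comment> \<open>Continuity of the tail holds at positive points; as \<open>A\<close> lies beyond
    \<open>b > 0\<close>, it is a closed preimage within \<open>{b..}\<close>.\<close>
  have "A = {b..} \<inter> levy_tail lam -` {..s}"
    using Ab b by (force simp: A_def)
  hence "closed A"
    using continuous_closed_preimage[OF cont, of "{..s}"] by auto
  moreover have bdd: "bdd_below A" using Ab by (auto intro!: bdd_belowI[of _ b] less_imp_le)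
  ultimately have rA: "r \<in> A" unfolding r_def using aA by (intro closed_contains_Inf) auto
  show "0 < levy_tail_inverse lam s" using rA r by (simp add: A_def)
  show "levy_tail_inverse lam s \<le> x \<longleftrightarrow> levy_tail lam x \<le> s" if "0 < x" for x
  proof
    assume "levy_tail_inverse lam s \<le> x"
    hence "levy_tail lam x \<le> levy_tail lam r"
      using rA r by (intro levy_tail_antimono[OF lam]) (auto simp: A_def)
    thus "levy_tail lam x \<le> s" using rA by (simp add: A_def)
  next
    assume "levy_tail lam x \<le> s"
    thus "levy_tail_inverse lam s \<le> x"
      using that bdd unfolding r r_def by (intro cInf_lower) (auto simp: A_def)
  qed
  have "b \<le> a" using Ab[OF aA] by simp
  \<comment> \<open>The tail takes the value \<open>s\<close> somewhere; \<open>r\<close> is not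
    beyond that point, so the tail at \<open>r\<close> cannot be below \<open>s\<close>.\<close>
  then obtain x where x: "b \<le> x" "x \<le> a" "levy_tail lam x = s"
    using IVT2[of "levy_tail lam" a s b] assms b isCont_levy_tail[OF lam] by auto
  have "r \<le> x" unfolding r_def using x b bdd by (intro cInf_lower) (auto simp: A_def)
  hence "s \<le> levy_tail lam r" using levy_tail_antimono[OF lam, of r x] rA x by (auto simp: A_def)
  thus "levy_tail lam (levy_tail_inverse lam s) = s" using rA r by (auto simp: A_def)
qed

text \<open>The inverse returns the left end of the stretch on which the tail has the value
  \<open>levy_tail lam x\<close>. Since \<open>lam x \<noteq> 0\<close>, the tail strictly decreases
  up to \<open>x\<close>, and this left end is \<open>x\<close> itself.\<close>

lemma levy_tail_inverse_levy_tail: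
  assumes lam: "continuous_levy_density lam" and x: "0 < x" "lam x \<noteq> 0"
  shows "levy_tail_inverse lam (levy_tail lam x) = x"
proof -
  let ?r = "levy_tail_inverse lam (levy_tail lam x)"
  have "?r \<le> x" using levy_tail_inverse_le_iff[OF lam, of x "levy_tail lam x" x] x by simp
  moreover have "\<not> ?r < x"
    using levy_tail_strict_antimono[OF lam, of ?r x x] x
      levy_tail_inverse_pos[OF lam, of x "levy_tail lam x"]
      levy_tail_levy_tail_inverse[OF lam, of x "levy_tail lam x"] by auto
  ultimately show ?thesis by simp
qed

text \<open>The inverse is monotone only where the set under the infimum is nonempty; elsewhere it
  is the constant \<open>Inf {}\<close>. The two regions are separated by a downward closed set,
  which is an interval.\<close>

lemma borel_measurable_levy_tail_inverse [measurable]: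
  "levy_tail_inverse lam \<in> borel_measurable borel"
proof -
  let ?A = "\<lambda>s. {t. t > 0 \<and> levy_tail lam t \<le> s}"
  let ?E = "{s. ?A s = {}}"
  have dc: "s' \<in> ?E" if "s \<in> ?E" "s' \<le> s" for s s'
    using that by (auto intro: order_trans)
  have E: "?E \<in> sets borel"
    by (intro real_interval_borel_measurable) (auto simp: is_interval_1 intro: dc)
  show ?thesis
  proof (rule measurable_piecewise_restrict[where C = "{?E, - ?E}"])
    fix \<Omega> assume "\<Omega> \<in> {?E, - ?E}"
    thus "levy_tail_inverse lam \<in> borel_measurable (restrict_space borel \<Omega>)"
    proof
      assume "\<Omega> = ?E"
      hence "levy_tail_inverse lam s = Inf {}" if "s \<in> \<Omega>" for s
        using that by (simp only: levy_tail_inverse_def mem_Collect_eq)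
      thus ?thesis
        by (subst measurable_cong[where g = "\<lambda>_. Inf {}"]) (auto simp: space_restrict_space)
    next
      assume "\<Omega> \<in> {- ?E}"
      hence O: "\<Omega> = - ?E" by simp
      have "mono_on \<Omega> (\<lambda>s. - levy_tail_inverse lam s)"
        unfolding O levy_tail_inverse_def
        by (intro mono_onI le_imp_neg_le cInf_superset_mono) (auto intro: bdd_belowI[of _ 0])
      hence "(\<lambda>s. - levy_tail_inverse lam s) \<in> borel_measurable (restrict_space borel \<Omega>)"
        by (rule borel_measurable_mono_on_fnc)
      from borel_measurable_uminus[OF this] show ?thesis by simp
    qed
  qed (use E in auto)
qed

subsection \<open>Laws of increasing sequences\<close>

definition arrival_paths :: "(nat \<Rightarrow> real) set" where
  "arrival_paths = {y. 0 < y 0 \<and> (\<forall>i. y i < y (Suc i))}"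

text \<open>For a nondecreasing \<open>\<tau>\<close> and a path in \<^const>\<open>arrival_paths\<close>, the event says that the cells
  \<open>(\<tau> j, \<tau> (j + 1)]\<close>, \<open>j \<le> 2 * n\<close>, contain no arrival if \<open>j\<close> is even and exactly one if \<open>j\<close> is odd. So
  it can be read off from counts, and these events are closed under intersection.\<close>

definition arrival_event :: "nat \<Rightarrow> (nat \<Rightarrow> real) \<Rightarrow> (nat \<Rightarrow> real) set" where
  "arrival_event n \<tau> =
     {y. (\<forall>i<n. \<tau> (2*i+1) < y i \<and> y i \<le> \<tau> (2*i+2)) \<and> \<tau> (2*n+1) < y n}"

text \<open>Only the entries up to \<open>2*n+1\<close> enter the event, so monotonicity stops
  there. Starting at 0 makes the cells cover everything from 0 to the last lower bound; degenerate
  cells are allowed.\<close>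

definition arrival_grid :: "nat \<Rightarrow> (nat \<Rightarrow> real) \<Rightarrow> bool" where
  "arrival_grid n \<tau> \<longleftrightarrow> \<tau> 0 = 0 \<and> (\<forall>j\<le>2*n. \<tau> j \<le> \<tau> (Suc j))"

abbreviation seq_space :: "(nat \<Rightarrow> real) measure" where
  "seq_space \<equiv> Pi\<^sub>M UNIV (\<lambda>_. borel)"

lemma sets_arrival_paths [measurable]: "arrival_paths \<in> sets seq_space"
proof -
  have "{y \<in> space seq_space. 0 < y 0 \<and> (\<forall>i. y i < y (Suc i))} \<in> sets seq_space"
    by measurable
  thus ?thesis by (simp add: arrival_paths_def space_PiM)
qed

lemma sets_arrival_event [measurable]: "arrival_event n \<tau> \<in> sets seq_space"
proof -
  have "{y \<in> space seq_space. (\<forall>i\<in>{..<n}. \<tau> (2*i+1) < y i \<and> y i \<le> \<tau> (2*i+2)) \<and> \<tau> (2*n+1) < y n}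
      \<in> sets seq_space"
    by measurable
  thus ?thesis by (simp add: arrival_event_def space_PiM Ball_def)
qed

text \<open>Odd entries are lower bounds and positive even ones upper bounds, so the constraints
  combine by maximum and minimum; past \<open>2*n+1\<close> only \<open>\<sigma>\<close>
  constrains.\<close>

lemma arrival_event_Int:
  assumes "n \<le> m" and \<tau>: "arrival_grid n \<tau>" and \<sigma>: "arrival_grid m \<sigma>"
    and ne: "arrival_event n \<tau> \<inter> arrival_event m \<sigma> \<noteq> {}"
  shows "\<exists>\<rho>. arrival_grid m \<rho> \<and> arrival_event n \<tau> \<inter> arrival_event m \<sigma> = arrival_event m \<rho>"
proof -
  define \<rho> where "\<rho> = (\<lambda>j. if 2*n+1 < j then \<sigma> j else if odd j then max (\<tau> j) (\<sigma> j) else min (\<tau> j) (\<sigma> j))"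
  have odd1: "\<rho> (2*i+1) = (if i \<le> n then max (\<tau> (2*i+1)) (\<sigma> (2*i+1)) else \<sigma> (2*i+1))" for i
    by (auto simp: \<rho>_def)
  have even2: "\<rho> (2*i+2) = (if i < n then min (\<tau> (2*i+2)) (\<sigma> (2*i+2)) else \<sigma> (2*i+2))" for i
    by (auto simp: \<rho>_def)
  have eq: "arrival_event n \<tau> \<inter> arrival_event m \<sigma> = arrival_event m \<rho>"
  proof (intro set_eqI iffI)
    fix y assume "y \<in> arrival_event n \<tau> \<inter> arrival_event m \<sigma>"
    hence y: "\<And>i. i < n \<Longrightarrow> \<tau> (2*i+1) < y i \<and> y i \<le> \<tau> (2*i+2)" "\<tau> (2*n+1) < y n"
      "\<And>i. i < m \<Longrightarrow> \<sigma> (2*i+1) < y i \<and> y i \<le> \<sigma> (2*i+2)" "\<sigma> (2*m+1) < y m"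
      by (auto simp: arrival_event_def)
    have "\<rho> (2*i+1) < y i" if "i \<le> m" for i
      using y(1,3)[of i] y(2,4) that \<open>n \<le> m\<close> unfolding odd1
      by (cases "i = m"; cases "i = n"; cases "i < n") auto
    moreover have "y i \<le> \<rho> (2*i+2)" if "i < m" for i
      using y(1,3)[of i] that unfolding even2 by auto
    ultimately show "y \<in> arrival_event m \<rho>" by (simp add: arrival_event_def)
  next
    fix y assume "y \<in> arrival_event m \<rho>"
    hence y: "\<And>i. i < m \<Longrightarrow> \<rho> (2*i+1) < y i \<and> y i \<le> \<rho> (2*i+2)" "\<rho> (2*m+1) < y m"
      by (auto simp: arrival_event_def)
    have lo: "\<rho> (2*i+1) < y i" if "i \<le> m" for i
      using y(1)[of i] y(2) that by (cases "i = m") auto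
    have lo': "\<sigma> (2*i+1) < y i \<and> (i \<le> n \<longrightarrow> \<tau> (2*i+1) < y i)" if "i \<le> m" for i
      using lo[OF that] unfolding odd1 by (cases "i \<le> n") auto
    have hi: "y i \<le> \<sigma> (2*i+2) \<and> (i < n \<longrightarrow> y i \<le> \<tau> (2*i+2))" if "i < m" for i
      using y(1)[OF that] unfolding even2 by (cases "i < n") auto
    show "y \<in> arrival_event n \<tau> \<inter> arrival_event m \<sigma>"
      using lo' hi \<open>n \<le> m\<close> by (simp add: arrival_event_def)
  qed
  \<comment> \<open>A maximum of lower bounds could exceed a minimum of upper bounds. A common path
    excludes this for odd \<open>j\<close>; for even \<open>j\<close> the two grids suffice.\<close>
  obtain y where y: "y \<in> arrival_event m \<rho>" using ne eq by auto
  have "\<rho> j \<le> \<rho> (Suc j)" if "j \<le> 2*m" for j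
  proof (cases "even j")
    case False
    then obtain i where i: "j = 2*i+1" by (auto elim: oddE)
    have "\<rho> (2*i+1) < y i" "y i \<le> \<rho> (2*i+2)"
      using y that by (auto simp: arrival_event_def i)
    thus ?thesis by (simp add: i)
  next
    case True
    hence "\<sigma> j \<le> \<sigma> (Suc j)" "j \<le> 2*n \<Longrightarrow> \<tau> j \<le> \<tau> (Suc j)"
      using \<tau> \<sigma> that by (auto simp: arrival_grid_def)
    thus ?thesis using True by (auto simp: \<rho>_def min_def max_def elim!: evenE)
  qed
  moreover have "\<rho> 0 = 0" using \<tau> \<sigma> by (simp add: \<rho>_def arrival_grid_def)
  ultimately show ?thesis using eq by (auto simp: arrival_grid_def)
qed

definition arrival_events :: "(nat \<Rightarrow> real) set set" where
  "arrival_events = {arrival_event n \<tau> \<inter> arrival_paths |n \<tau>. arrival_grid n \<tau>}"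

lemma Int_stable_arrival_events: "Int_stable arrival_events"
proof (rule Int_stableI)
  have empty: "{} \<in> arrival_events"
  proof -
    \<comment> \<open>Disjoint events yield no combined grid, so the empty set is represented on its
      own: this event demands \<open>0 < y 0 \<le> 0\<close>.\<close>
    have "{} = arrival_event 1 (\<lambda>_. 0) \<inter> arrival_paths" "arrival_grid 1 (\<lambda>_. 0)"
      by (auto simp: arrival_event_def arrival_grid_def)
    thus ?thesis by (auto simp: arrival_events_def)
  qed
  have *: "(arrival_event n \<tau> \<inter> arrival_paths) \<inter> (arrival_event m \<sigma> \<inter> arrival_paths) \<in> arrival_events"
    if "n \<le> m" "arrival_grid n \<tau>" "arrival_grid m \<sigma>" for n m \<tau> \<sigma>
  proof (cases "arrival_event n \<tau> \<inter> arrival_event m \<sigma> = {}")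
    case True
    hence "(arrival_event n \<tau> \<inter> arrival_paths) \<inter> (arrival_event m \<sigma> \<inter> arrival_paths) = {}" by auto
    thus ?thesis using empty by simp
  next
    case False
    then obtain \<rho> where "arrival_grid m \<rho>"
      "arrival_event n \<tau> \<inter> arrival_event m \<sigma> = arrival_event m \<rho>"
      using arrival_event_Int[OF \<open>n \<le> m\<close> \<open>arrival_grid n \<tau>\<close> \<open>arrival_grid m \<sigma>\<close> False] by auto
    moreover from this(2) have "(arrival_event n \<tau> \<inter> arrival_paths) \<inter> (arrival_event m \<sigma> \<inter> arrival_paths)
        = arrival_event m \<rho> \<inter> arrival_paths" by auto
    ultimately show ?thesis by (auto simp: arrival_events_def)
  qed
  fix A B assume "A \<in> arrival_events" "B \<in> arrival_events"
  then obtain n m \<tau> \<sigma> where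
    "A = arrival_event n \<tau> \<inter> arrival_paths" "B = arrival_event m \<sigma> \<inter> arrival_paths"
    "arrival_grid n \<tau>" "arrival_grid m \<sigma>" by (auto simp: arrival_events_def)
  thus "A \<inter> B \<in> arrival_events"
    using *[of n m \<tau> \<sigma>] *[of m n \<sigma> \<tau>] by (cases "n \<le> m") (auto simp: Int_commute)
qed

text \<open>Rationals fit strictly between successive arrivals, so finite rational lists, of which
  there are countably many, suffice as grids. By \<open>j div 2\<close>, each entry after the first
  is both the upper bound of one arrival and the lower bound of the next.\<close>

lemma arrival_paths_greater_eq_UN:
  defines "\<tau> \<equiv> \<lambda>(l::rat list) j. if j = 0 then 0 else real_of_rat (l ! (j div 2))"
  shows "{y \<in> arrival_paths. t < y i} =
    (\<Union>l\<in>{l. arrival_grid i (\<tau> l) \<and> t \<le> \<tau> l (2*i+1)}. arrival_event i (\<tau> l) \<inter> arrival_paths)"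
proof (intro set_eqI iffI)
  fix y assume "y \<in> {y \<in> arrival_paths. t < y i}"
  hence y: "y \<in> arrival_paths" "t < y i" by auto
  \<comment> \<open>The rational chosen below \<open>y k\<close> has to exceed the preceding
    arrival, or 0 at the start, and for \<open>k = i\<close> also the level
    \<open>t\<close>.\<close>
  define b where "b = (\<lambda>k. max (if k = 0 then 0 else y (k - 1)) (if k = i then t else 0))"
  have pos: "0 < y k" for k
    using y by (induction k) (auto simp: arrival_paths_def intro: less_trans)
  have "b k < y k" for k
    using y pos by (cases k) (auto simp: b_def arrival_paths_def)
  hence "\<exists>q. b k < real_of_rat q \<and> real_of_rat q < y k" for k
    by (metis of_rat_dense)
  then obtain q where q: "b k < real_of_rat (q k)" "real_of_rat (q k) < y k" for k by metis
  define l where "l = map q [0..<Suc i]"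
  have odd1: "\<tau> l (2*k+1) = real_of_rat (q k)" if "k \<le> i" for k
    using that by (simp add: \<tau>_def l_def nth_append del: upt_Suc)
  have even2: "\<tau> l (2*k+2) = real_of_rat (q (Suc k))" if "k < i" for k
    using that by (simp add: \<tau>_def l_def nth_append del: upt_Suc)
  have q0: "0 < real_of_rat (q 0)" and qS: "y k < real_of_rat (q (Suc k))" for k
    using q(1)[of 0] q(1)[of "Suc k"] by (auto simp: b_def split: if_splits)
  have "\<tau> l j \<le> \<tau> l (Suc j)" if "j \<le> 2*i" for j
  proof (cases "even j")
    case False
    then obtain k where k: "j = 2*k+1" by (auto elim: oddE)
    have "real_of_rat (q k) < real_of_rat (q (Suc k))"
      by (rule less_trans[OF q(2) qS])
    thus ?thesis using odd1[of k] even2[of k] that by (simp add: k)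
  next
    case True
    then obtain k where "j = 2*k" by (auto elim: evenE)
    thus ?thesis using q0 that odd1[of k] even2[of "k - 1"]
      by (cases k) (auto simp: \<tau>_def l_def nth_append simp del: upt_Suc)
  qed
  hence "arrival_grid i (\<tau> l)" by (auto simp: arrival_grid_def \<tau>_def)
  moreover have "t \<le> \<tau> l (2*i+1)"
    using q(1)[of i] odd1[of i] by (simp add: b_def split: if_splits)
  moreover have "y \<in> arrival_event i (\<tau> l)"
    using q(2) qS odd1 even2 by (auto simp: arrival_event_def less_imp_le)
  ultimately show "y \<in> (\<Union>l\<in>{l. arrival_grid i (\<tau> l) \<and> t \<le> \<tau> l (2*i+1)}. arrival_event i (\<tau> l) \<inter> arrival_paths)"
    using y by auto
qed (auto simp: arrival_event_def)

text \<open>The countable unions above make each coordinate measurable for the generated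
  sigma-algebra, so the identity into \<open>seq_space\<close> is measurable and its preimages are
  the traces. Conversely the traces form a sigma-algebra containing the generators.\<close>

lemma sigma_sets_arrival_events:
  "{A \<inter> arrival_paths |A. A \<in> sets seq_space} = sigma_sets arrival_paths arrival_events"
proof -
  have sub: "arrival_events \<subseteq> Pow arrival_paths" by (auto simp: arrival_events_def)
  let ?S = "sigma arrival_paths arrival_events"
  have sS: "sets ?S = sigma_sets arrival_paths arrival_events" "space ?S = arrival_paths"
    using sub by (simp_all add: sets_measure_of space_measure_of)
  have "(\<lambda>y. y i) \<in> borel_measurable ?S" for i
  proof (rule borel_measurableI_greater)
    fix t :: real
    have "{y \<in> arrival_paths. t < y i} \<in> sets ?S"
      unfolding arrival_paths_greater_eq_UN
    proof (rule sets.countable_UN')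
      show "(\<lambda>l. arrival_event i (\<lambda>j. if j = 0 then 0 else real_of_rat (l ! (j div 2))) \<inter> arrival_paths) `
        {l. arrival_grid i (\<lambda>j. if j = 0 then 0 else real_of_rat (l ! (j div 2))) \<and>
            t \<le> (if 2 * i + 1 = 0 then 0 else real_of_rat (l ! ((2 * i + 1) div 2)))} \<subseteq> sets ?S"
        unfolding sS by (auto simp: arrival_events_def intro!: sigma_sets.Basic)
    qed simp
    thus "{y \<in> space ?S. t < y i} \<in> sets ?S" by (simp add: sS)
  qed
  hence id: "(\<lambda>y. y) \<in> ?S \<rightarrow>\<^sub>M seq_space"
    by (intro measurable_PiM_single') auto
  show ?thesis
  proof (intro equalityI subsetI)
    fix B assume "B \<in> {A \<inter> arrival_paths |A. A \<in> sets seq_space}"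
    then obtain A where A: "A \<in> sets seq_space" "B = A \<inter> arrival_paths" by auto
    show "B \<in> sigma_sets arrival_paths arrival_events"
      using measurable_sets[OF id A(1)] by (simp add: A sS)
  next
    have sa: "sigma_algebra arrival_paths {A \<inter> arrival_paths |A. A \<in> sets seq_space}"
      using sets.restricted_sigma_algebra[OF sets_arrival_paths]
      by (simp add: image_def Int_commute Collect_conj_eq conj_commute Bex_def)
    have sub': "arrival_events \<subseteq> {A \<inter> arrival_paths |A. A \<in> sets seq_space}"
      by (auto simp: arrival_events_def intro: sets_arrival_event)
    fix B assume "B \<in> sigma_sets arrival_paths arrival_events"
    thus "B \<in> {A \<inter> arrival_paths |A. A \<in> sets seq_space}"
      using sigma_algebra.sigma_sets_subset[OF sa sub'] by blast
  qed
qed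

text \<open>Both laws live on \<open>arrival_paths\<close>, so they may be restricted to it, where
  the events are a generator closed under intersection and the uniqueness theorem for measures
  applies.\<close>

lemma arrival_law_unique:
  assumes "finite_measure P"
    and sP: "sets P = sets seq_space" and sQ: "sets Q = sets seq_space"
    and P: "AE y in P. y \<in> arrival_paths" and Q: "AE y in Q. y \<in> arrival_paths"
    and eq: "\<And>n \<tau>. arrival_grid n \<tau> \<Longrightarrow> emeasure P (arrival_event n \<tau>) = emeasure Q (arrival_event n \<tau>)"
  shows "P = Q"
proof -
  interpret P: finite_measure P by fact
  let ?P = "restrict_space P arrival_paths" and ?Q = "restrict_space Q arrival_paths"
  have int: "emeasure R (A \<inter> arrival_paths) = emeasure R A"
    if "sets R = sets seq_space" "AE y in R. y \<in> arrival_paths" "A \<in> sets seq_space" for R A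
    using that by (intro emeasure_eq_AE) auto
  have res: "sets (restrict_space R arrival_paths) = sigma_sets arrival_paths arrival_events"
    if "sets R = sets seq_space" for R
    unfolding sigma_sets_arrival_events[symmetric] sets_restrict_space using that by auto
  have em: "emeasure (restrict_space R arrival_paths) (A \<inter> arrival_paths) = emeasure R A"
    if "sets R = sets seq_space" "AE y in R. y \<in> arrival_paths" "A \<in> sets seq_space" for R A
    using that int[OF that] sets_eq_imp_space_eq[OF that(1)]
    by (subst emeasure_restrict_space) (auto simp: space_PiM)
  have "?P = ?Q"
  proof (rule measure_eqI_generator_eq[OF Int_stable_arrival_events])
    show "arrival_events \<subseteq> Pow arrival_paths" by (auto simp: arrival_events_def)
    show "sets ?P = sigma_sets arrival_paths arrival_events"
      "sets ?Q = sigma_sets arrival_paths arrival_events" using res sP sQ by auto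
    show "emeasure ?P X = emeasure ?Q X" if "X \<in> arrival_events" for X
      using that em[OF sP P] em[OF sQ Q] eq by (auto simp: arrival_events_def)
    \<comment> \<open>The event with \<open>n = 0\<close> and level 0 only asks that the first
      arrival be positive, so the whole space is itself a generator of finite measure.\<close>
    have top: "arrival_paths = arrival_event 0 (\<lambda>_. 0) \<inter> arrival_paths"
      by (auto simp: arrival_event_def arrival_paths_def)
    show "range (\<lambda>_::nat. arrival_paths) \<subseteq> arrival_events"
      using top by (auto simp: arrival_events_def arrival_grid_def intro!: exI[of _ 0] exI[of _ "\<lambda>_. 0"])
    show "emeasure ?P arrival_paths \<noteq> \<infinity>" for i :: nat
      using em[OF sP P sets_arrival_paths] by simp
  qed auto
  show ?thesis
  proof (rule measure_eqI)
    fix A assume "A \<in> sets P"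
    thus "emeasure P A = emeasure Q A"
      using em[OF sP P, of A] em[OF sQ Q, of A] sP \<open>?P = ?Q\<close> by simp
  qed (simp add: sP sQ)
qed

subsection \<open>Partial sums of exponential variables\<close>

text \<open>As \<open>w \<le> c\<close>, the window forces \<open>x > 0\<close>, where the weight
  \<open>exp (w + x)\<close> cancels the density \<open>exp (- x)\<close> and leaves the constant
  \<open>exp w\<close>.\<close>

lemma exponential_window_nn_integral:
  assumes "w \<le> c" "c \<le> d"
  shows "(\<integral>\<^sup>+x. indicator {c<..d} (w + x) * ennreal (exp (w + x))
           \<partial>density lborel (exponential_density 1)) = ennreal (exp w) * ennreal (d - c)"
proof -
  have "(\<integral>\<^sup>+x. indicator {c<..d} (w + x) * ennreal (exp (w + x)) \<partial>density lborel (exponential_density 1))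
      = (\<integral>\<^sup>+x. ennreal (exponential_density 1 x) * (indicator {c<..d} (w + x) * ennreal (exp (w + x))) \<partial>lborel)"
    by (rule nn_integral_density) measurable
  also have "\<dots> = (\<integral>\<^sup>+x. ennreal (exp w) * indicator {c-w<..d-w} x \<partial>lborel)"
    using assms
    by (intro nn_integral_cong)
       (auto simp: exponential_density_def exp_add exp_minus field_simps
         ennreal_mult'[symmetric] split: split_indicator)
  also have "\<dots> = ennreal (exp w) * ennreal (d - c)"
    using assms by (simp add: nn_integral_cmult_indicator)
  finally show ?thesis .
qed

text \<open>As \<open>w \<le> c\<close>, this is the survival probability of an exponential variable
  at \<open>c - w\<close>, split into a factor in \<open>c\<close> and a factor in
  \<open>w\<close>.\<close>

lemma exponential_tail_nn_integral:
  assumes "w \<le> c"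
  shows "(\<integral>\<^sup>+x. indicator {c<..} (w + x) \<partial>density lborel (exponential_density 1))
    = ennreal (exp (- c)) * ennreal (exp w)"
proof -
  interpret D: prob_space "density lborel (exponential_density 1)"
    by (rule prob_space_exponential_density) simp
  have dist: "distributed (density lborel (exponential_density 1)) lborel (\<lambda>x. x) (exponential_density 1)"
    by (auto simp: distributed_def distr_id2)
  have "(\<integral>\<^sup>+x. indicator {c<..} (w + x) \<partial>density lborel (exponential_density 1))
      = (\<integral>\<^sup>+x. indicator {c-w<..} x \<partial>density lborel (exponential_density 1))"
    by (intro nn_integral_cong) (auto split: split_indicator)
  also have "\<dots> = ennreal (D.prob {c-w<..})"
    by (simp add: D.emeasure_eq_measure)
  also have "D.prob {c-w<..} = exp (- (c - w))"
    using D.exponential_distributedD_gt[OF dist, of "c - w"] assms by (simp add: greaterThan_def)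
  also have "ennreal \<dots> = ennreal (exp (- c)) * ennreal (exp w)"
    by (simp add: ennreal_mult'[symmetric] exp_add[symmetric])
  finally show ?thesis .
qed

abbreviation exp_measure :: "nat \<Rightarrow> real measure" where
  "exp_measure \<equiv> \<lambda>_. density lborel (exponential_density 1)"

lemma product_sigma_finite_exp_measure: "product_sigma_finite exp_measure"
  by (intro product_sigma_finite.intro prob_space_imp_sigma_finite prob_space_exponential_density) simp

lemma sum_fun_upd_outside:
  "k \<notin> A \<Longrightarrow> (\<Sum>j\<in>A. (x(k := v)) j) = (\<Sum>j\<in>A. x j :: real)"
  by (intro sum.cong) auto

lemma borel_measurable_partial_sum:
  "k \<le> n \<Longrightarrow> (\<lambda>x. \<Sum>j<k. x j) \<in> borel_measurable (Pi\<^sub>M {..<n} exp_measure)"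
  by (intro borel_measurable_sum measurable_compose[OF measurable_component_singleton]) auto

text \<open>Integrates out the last waiting time by Fubini: the window indicators depend only on the
  earlier ones.\<close>

lemma nn_integral_exp_measure_Suc:
  fixes \<tau> :: "nat \<Rightarrow> real" and g :: "real \<Rightarrow> ennreal"
  assumes [measurable]: "g \<in> borel_measurable borel" "h \<in> borel_measurable borel"
    and grid: "\<And>j. j \<le> 2*n \<Longrightarrow> \<tau> j \<le> \<tau> (Suc j)" "\<tau> 0 = 0"
    and step: "\<And>w. w \<le> \<tau> (2*n+1) \<Longrightarrow>
      (\<integral>\<^sup>+y. g (w + y) \<partial>density lborel (exponential_density 1)) = h w"
  shows "(\<integral>\<^sup>+x. (\<Prod>i<n. indicator {\<tau> (2*i+1)<..\<tau> (2*i+2)} (\<Sum>j<Suc i. x j)) * g (\<Sum>j<Suc n. x j)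
        \<partial>Pi\<^sub>M {..<Suc n} exp_measure)
    = (\<integral>\<^sup>+x. (\<Prod>i<n. indicator {\<tau> (2*i+1)<..\<tau> (2*i+2)} (\<Sum>j<Suc i. x j)) * h (\<Sum>j<n. x j)
        \<partial>Pi\<^sub>M {..<n} exp_measure)"
proof -
  interpret product_sigma_finite exp_measure by (rule product_sigma_finite_exp_measure)
  let ?B = "\<lambda>x. \<Prod>i<n. indicator {\<tau> (2*i+1)<..\<tau> (2*i+2)} (\<Sum>j<Suc i. x j) :: ennreal"
  let ?W = "\<lambda>x. \<Sum>j<n. x j :: real"
  have upd: "(\<Sum>j<i. (x(n := y)) j) = (\<Sum>j<i. x j)" if "i \<le> n" for x :: "nat \<Rightarrow> real" and y i
    using that by (intro sum_fun_upd_outside) auto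
  have B: "?B (x(n := y)) = ?B x" for x y
    by (intro prod.cong arg_cong[where f = "indicator _"] upd) auto
  have m: "(\<lambda>x. ?B x * g (\<Sum>j<Suc n. x j)) \<in> borel_measurable (Pi\<^sub>M (insert n {..<n}) exp_measure)"
    unfolding lessThan_Suc[symmetric]
    by (intro borel_measurable_times_ennreal borel_measurable_prod_ennreal
        measurable_compose[OF borel_measurable_partial_sum] borel_measurable_indicator assms) auto
  have "(\<integral>\<^sup>+x. ?B x * g (\<Sum>j<Suc n. x j) \<partial>Pi\<^sub>M {..<Suc n} exp_measure)
      = (\<integral>\<^sup>+x. (\<integral>\<^sup>+y. ?B (x(n := y)) * g (\<Sum>j<Suc n. (x(n := y)) j)
          \<partial>density lborel (exponential_density 1)) \<partial>Pi\<^sub>M {..<n} exp_measure)"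
    unfolding lessThan_Suc[of n] using m by (intro product_nn_integral_insert) (auto simp: lessThan_Suc)
  also have "\<dots> = (\<integral>\<^sup>+x. ?B x * (\<integral>\<^sup>+y. g (?W x + y)
          \<partial>density lborel (exponential_density 1)) \<partial>Pi\<^sub>M {..<n} exp_measure)"
    unfolding B sum.lessThan_Suc[of _ n] upd[OF order_refl] fun_upd_same
    by (intro nn_integral_cong nn_integral_cmult) measurable
  also have "\<dots> = (\<integral>\<^sup>+x. ?B x * h (?W x) \<partial>Pi\<^sub>M {..<n} exp_measure)"
  proof (intro nn_integral_cong)
    fix x :: "nat \<Rightarrow> real"
    show "?B x * (\<integral>\<^sup>+y. g (?W x + y) \<partial>density lborel (exponential_density 1)) = ?B x * h (?W x)"
    proof (cases "?B x = 0")
      case False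
      \<comment> \<open>\<open>step\<close> is available only for such \<open>w\<close>. The last
        window bounds the partial sum by \<open>\<tau> (2*n)\<close>; for \<open>n = 0\<close> the
        sum is empty and equals \<open>\<tau> 0\<close>.\<close>
      have "?W x \<le> \<tau> (2*n+1)"
      proof (cases n)
        case 0
        thus ?thesis using grid(1)[of 0] grid(2) by simp
      next
        case (Suc m)
        hence "?W x \<le> \<tau> (2*m+2)" using False by (auto split: split_indicator_asm)
        also have "\<dots> \<le> \<tau> (2*n+1)" using grid(1)[of "2*n"] by (simp add: Suc)
        finally show ?thesis .
      qed
      from step[OF this] show ?thesis by simp
    next
      case True
      show ?thesis unfolding True by simp
    qed
  qed
  finally show ?thesis .
qed

text \<open>The weight \<open>exp\<close> of the last arrival time compensates the exponential density of the next
  waiting time, which makes the iterated integral a product.\<close>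

lemma exp_partial_sums_window:
  fixes \<tau> :: "nat \<Rightarrow> real"
  assumes "\<And>j. j \<le> 2*n \<Longrightarrow> \<tau> j \<le> \<tau> (Suc j)" and "\<tau> 0 = 0"
  shows "(\<integral>\<^sup>+x. (\<Prod>i<n. indicator {\<tau> (2*i+1)<..\<tau> (2*i+2)} (\<Sum>j<Suc i. x j))
      * ennreal (exp (\<Sum>j<n. x j)) \<partial>Pi\<^sub>M {..<n} exp_measure)
    = (\<Prod>i<n. ennreal (\<tau> (2*i+2) - \<tau> (2*i+1)))"
  using assms(1)
proof (induction n)
  case 0
  have "emeasure (Pi\<^sub>M {} exp_measure) (space (Pi\<^sub>M {} exp_measure)) = 1"
    by (intro prob_space.emeasure_space_1 prob_space_PiM prob_space_exponential_density) simp
  thus ?case by simp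
next
  case (Suc n)
  let ?B = "\<lambda>x. \<Prod>i<n. indicator {\<tau> (2*i+1)<..\<tau> (2*i+2)} (\<Sum>j<Suc i. x j) :: ennreal"
  let ?I = "{\<tau> (2*n+1)<..\<tau> (2*n+2)}" and ?l = "ennreal (\<tau> (2*n+2) - \<tau> (2*n+1))"
  have "(\<integral>\<^sup>+x. (\<Prod>i<Suc n. indicator {\<tau> (2*i+1)<..\<tau> (2*i+2)} (\<Sum>j<Suc i. x j))
      * ennreal (exp (\<Sum>j<Suc n. x j)) \<partial>Pi\<^sub>M {..<Suc n} exp_measure)
    = (\<integral>\<^sup>+x. ?B x * (indicator ?I (\<Sum>j<Suc n. x j) * ennreal (exp (\<Sum>j<Suc n. x j)))
        \<partial>Pi\<^sub>M {..<Suc n} exp_measure)"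
    by (simp only: prod.lessThan_Suc mult.assoc)
  also have "\<dots> = (\<integral>\<^sup>+x. ?B x * (ennreal (exp (\<Sum>j<n. x j)) * ?l) \<partial>Pi\<^sub>M {..<n} exp_measure)"
    using Suc.prems assms(2)
    by (intro nn_integral_exp_measure_Suc[where g = "\<lambda>w. indicator ?I w * ennreal (exp w)"
          and h = "\<lambda>w. ennreal (exp w) * ?l"] exponential_window_nn_integral) auto
  also have "\<dots> = (\<integral>\<^sup>+x. ?B x * ennreal (exp (\<Sum>j<n. x j)) \<partial>Pi\<^sub>M {..<n} exp_measure) * ?l"
    unfolding mult.assoc[symmetric]
    by (intro nn_integral_multc borel_measurable_times_ennreal borel_measurable_prod_ennreal
        measurable_compose[OF borel_measurable_partial_sum] borel_measurable_indicator) auto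
  also have "\<dots> = (\<Prod>i<n. ennreal (\<tau> (2*i+2) - \<tau> (2*i+1))) * ?l"
    by (subst Suc.IH) (use Suc.prems in auto)
  finally show ?case by simp
qed

text \<open>The survival probability of the last waiting time contributes \<open>exp\<close> of the
  previous partial sum, which is exactly the weight in
  \<open>exp_partial_sums_window\<close>.\<close>

lemma exp_partial_sums_arrival_event:
  assumes "arrival_grid n \<tau>"
  shows "(\<integral>\<^sup>+x. (\<Prod>i<n. indicator {\<tau> (2*i+1)<..\<tau> (2*i+2)} (\<Sum>j<Suc i. x j))
      * indicator {\<tau> (2*n+1)<..} (\<Sum>j<Suc n. x j) \<partial>Pi\<^sub>M {..<Suc n} exp_measure)
    = ennreal (exp (- \<tau> (2*n+1)) * (\<Prod>i<n. \<tau> (2*i+2) - \<tau> (2*i+1)))"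
proof -
  let ?B = "\<lambda>x. \<Prod>i<n. indicator {\<tau> (2*i+1)<..\<tau> (2*i+2)} (\<Sum>j<Suc i. x j) :: ennreal"
  have grid: "\<And>j. j \<le> 2*n \<Longrightarrow> \<tau> j \<le> \<tau> (Suc j)" "\<tau> 0 = 0"
    using assms by (auto simp: arrival_grid_def)
  have "(\<integral>\<^sup>+x. ?B x * indicator {\<tau> (2*n+1)<..} (\<Sum>j<Suc n. x j) \<partial>Pi\<^sub>M {..<Suc n} exp_measure)
    = (\<integral>\<^sup>+x. ?B x * (ennreal (exp (- \<tau> (2*n+1))) * ennreal (exp (\<Sum>j<n. x j))) \<partial>Pi\<^sub>M {..<n} exp_measure)"
    using grid
    by (intro nn_integral_exp_measure_Suc[where g = "\<lambda>w. indicator {\<tau> (2*n+1)<..} w"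
          and h = "\<lambda>w. ennreal (exp (- \<tau> (2*n+1))) * ennreal (exp w)"] exponential_tail_nn_integral) auto
  also have "\<dots> = ennreal (exp (- \<tau> (2*n+1))) * (\<integral>\<^sup>+x. ?B x * ennreal (exp (\<Sum>j<n. x j)) \<partial>Pi\<^sub>M {..<n} exp_measure)"
    unfolding mult.left_commute[of _ "ennreal (exp (- \<tau> (2*n+1)))"]
    by (intro nn_integral_cmult borel_measurable_times_ennreal borel_measurable_prod_ennreal
        measurable_compose[OF borel_measurable_partial_sum] borel_measurable_indicator) auto
  also have "\<dots> = ennreal (exp (- \<tau> (2*n+1)) * (\<Prod>i<n. \<tau> (2*i+2) - \<tau> (2*i+1)))"
  proof -
    have nn: "0 \<le> \<tau> (2*i+2) - \<tau> (2*i+1)" if "i < n" for i using grid(1)[of "2*i+1"] that by simp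
    have "(\<Prod>i<n. ennreal (\<tau> (2*i+2) - \<tau> (2*i+1))) = ennreal (\<Prod>i<n. \<tau> (2*i+2) - \<tau> (2*i+1))"
      using nn by (intro prod_ennreal) auto
    thus ?thesis
      using exp_partial_sums_window[of n \<tau>] grid by (simp add: ennreal_mult')
  qed
  finally show ?thesis .
qed

text \<open>The event depends on the first \<open>n + 1\<close> waiting times only, and by
  independence their joint law is the finite product of exponential laws.\<close>

lemma (in prob_space) exponential_sums_arrival_event:
  assumes ind: "indep_vars (\<lambda>_. borel) E UNIV"
    and E: "\<And>i::nat. distributed M lborel (E i) (exponential_density 1)"
    and grid: "arrival_grid n \<tau>"
  shows "emeasure M {\<omega> \<in> space M. (\<lambda>k. \<Sum>j\<le>k. E j \<omega>) \<in> arrival_event n \<tau>}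
    = ennreal (exp (- \<tau> (2*n+1)) * (\<Prod>i<n. \<tau> (2*i+2) - \<tau> (2*i+1)))"
proof -
  have [measurable]: "E i \<in> borel_measurable M" for i
    using distributed_measurable[OF E[of i]] by simp
  let ?f = "\<lambda>x. (\<Prod>i<n. indicator {\<tau> (2*i+1)<..\<tau> (2*i+2)} (\<Sum>j<Suc i. x j))
      * indicator {\<tau> (2*n+1)<..} (\<Sum>j<Suc n. x j) :: ennreal"
  have "distr M (Pi\<^sub>M {..<Suc n} (\<lambda>_. borel)) (\<lambda>\<omega>. \<lambda>i\<in>{..<Suc n}. E i \<omega>)
      = Pi\<^sub>M {..<Suc n} (\<lambda>i. distr M borel (E i))"
    using indep_vars_subset[OF ind, of "{..<Suc n}"]
      indep_vars_iff_distr_eq_PiM[of "{..<Suc n}" E "\<lambda>_. borel"] by auto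
  also have "(\<lambda>i. distr M borel (E i)) = exp_measure"
  proof
    fix i
    have "distr M borel (E i) = distr M lborel (E i)" by (intro distr_cong) auto
    thus "distr M borel (E i) = exp_measure i"
      using distributed_distr_eq_density[OF E[of i]] by simp
  qed
  finally have D: "distr M (Pi\<^sub>M {..<Suc n} (\<lambda>_. borel)) (\<lambda>\<omega>. \<lambda>i\<in>{..<Suc n}. E i \<omega>)
      = Pi\<^sub>M {..<Suc n} exp_measure" .
  have [simp]: "sets (Pi\<^sub>M {..<Suc n} exp_measure) = sets (Pi\<^sub>M {..<Suc n} (\<lambda>_. borel))"
    by (intro sets_PiM_cong) auto
  have mf: "?f \<in> borel_measurable (Pi\<^sub>M {..<Suc n} exp_measure)"
    by (intro borel_measurable_times_ennreal borel_measurable_prod_ennreal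
        measurable_compose[OF borel_measurable_partial_sum] borel_measurable_indicator) auto
  hence mf': "?f \<in> borel_measurable (Pi\<^sub>M {..<Suc n} (\<lambda>_. borel))"
    by (simp cong: measurable_cong_sets)
  have "emeasure M {\<omega> \<in> space M. (\<lambda>k. \<Sum>j\<le>k. E j \<omega>) \<in> arrival_event n \<tau>}
      = (\<integral>\<^sup>+\<omega>. indicator {\<omega> \<in> space M. (\<lambda>k. \<Sum>j\<le>k. E j \<omega>) \<in> arrival_event n \<tau>} \<omega> \<partial>M)"
  proof (rule nn_integral_indicator[symmetric])
    have "(\<lambda>\<omega>. \<lambda>k. \<Sum>j\<le>k. E j \<omega>) \<in> M \<rightarrow>\<^sub>M seq_space"
      by (intro measurable_PiM_single') auto
    thus "{\<omega> \<in> space M. (\<lambda>k. \<Sum>j\<le>k. E j \<omega>) \<in> arrival_event n \<tau>} \<in> sets M"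
      by measurable
  qed
  also have "\<dots> = (\<integral>\<^sup>+\<omega>. ?f (\<lambda>i\<in>{..<Suc n}. E i \<omega>) \<partial>M)"
  proof (intro nn_integral_cong)
    fix \<omega> assume "\<omega> \<in> space M"
    have r: "(\<Sum>j<Suc i. (\<lambda>i\<in>{..<Suc n}. E i \<omega>) j) = (\<Sum>j\<le>i. E j \<omega>)" if "i \<le> n" for i
      using that by (intro sum.cong) auto
    have "?f (\<lambda>i\<in>{..<Suc n}. E i \<omega>)
        = (\<Prod>i<n. indicator {\<tau> (2*i+1)<..\<tau> (2*i+2)} (\<Sum>j\<le>i. E j \<omega>)) * indicator {\<tau> (2*n+1)<..} (\<Sum>j\<le>n. E j \<omega>)"
      by (intro arg_cong2[where f = "(*)"] prod.cong arg_cong[where f = "indicator _"] r) auto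
    also have "\<dots> = indicator {\<omega> \<in> space M. (\<lambda>k. \<Sum>j\<le>k. E j \<omega>) \<in> arrival_event n \<tau>} \<omega>"
    proof (cases "(\<lambda>k. \<Sum>j\<le>k. E j \<omega>) \<in> arrival_event n \<tau>")
      case True
      thus ?thesis using \<open>\<omega> \<in> space M\<close> by (auto simp: arrival_event_def)
    next
      case False
      thus ?thesis by (auto simp: arrival_event_def split: split_indicator)
    qed
    finally show "indicator {\<omega> \<in> space M. (\<lambda>k. \<Sum>j\<le>k. E j \<omega>) \<in> arrival_event n \<tau>} \<omega>
        = ?f (\<lambda>i\<in>{..<Suc n}. E i \<omega>)" by simp
  qed
  also have "\<dots> = (\<integral>\<^sup>+x. ?f x \<partial>distr M (Pi\<^sub>M {..<Suc n} (\<lambda>_. borel)) (\<lambda>\<omega>. \<lambda>i\<in>{..<Suc n}. E i \<omega>))"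
    using mf' by (intro nn_integral_distr[symmetric] measurable_restrict) auto
  finally show ?thesis
    unfolding D exp_partial_sums_arrival_event[OF grid] .
qed

lemma (in prob_space) AE_exponential_sums_arrival_paths:
  assumes E: "\<And>i::nat. distributed M lborel (E i) (exponential_density 1)"
  shows "AE \<omega> in M. (\<lambda>k. \<Sum>j\<le>k. E j \<omega>) \<in> arrival_paths"
proof -
  have "AE \<omega> in M. 0 < E i \<omega>" for i
  proof -
    have "prob {\<omega> \<in> space M. 0 < E i \<omega>} = 1"
      using exponential_distributedD_gt[OF E[of i], of 0] by simp
    moreover have "{\<omega> \<in> space M. 0 < E i \<omega>} \<in> events"
      using distributed_measurable[OF E[of i]] by measurable
    ultimately show ?thesis by (subst (asm) prob_Collect_eq_1) auto
  qed
  hence "AE \<omega> in M. \<forall>i. 0 < E i \<omega>" by (simp add: AE_all_countable)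
  thus ?thesis by eventually_elim (auto simp: arrival_paths_def)
qed

text \<open>Serves to let the exponential variables start at index 0. Injectivity allows events to
  be renamed along \<open>f\<close> without two of them sharing a variable.\<close>

lemma (in prob_space) indep_vars_reindex:
  assumes inj: "inj_on f I" and ind: "indep_vars (\<lambda>_. N) X (f ` I)"
  shows "indep_vars (\<lambda>_. N) (\<lambda>i. X (f i)) I"
  unfolding indep_vars_def2
proof (intro conjI ballI indep_setsI)
  let ?F = "\<lambda>i. {X i -` A \<inter> space M |A. A \<in> sets N}"
  have rv: "X (f i) \<in> M \<rightarrow>\<^sub>M N" if "i \<in> I" for i
    using ind that by (auto simp: indep_vars_def2)
  show "X (f i) \<in> M \<rightarrow>\<^sub>M N" if "i \<in> I" for i by (rule rv[OF that])
  show "?F (f i) \<subseteq> events" if "i \<in> I" for i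
    using rv[OF that] by (auto intro: measurable_sets)
  fix A J assume J: "J \<noteq> {}" "J \<subseteq> I" "finite J" and A: "\<forall>j\<in>J. A j \<in> ?F (f j)"
  have injJ: "inj_on f J" using inj J by (auto intro: inj_on_subset)
  have inv: "the_inv_into J f (f j) = j" if "j \<in> J" for j
    using injJ that by (rule the_inv_into_f_f)
  have "prob (\<Inter>k\<in>f ` J. A (the_inv_into J f k)) = (\<Prod>k\<in>f ` J. prob (A (the_inv_into J f k)))"
  proof (rule indep_setsD)
    show "indep_sets ?F (f ` I)" using ind by (simp add: indep_vars_def2)
  qed (use J A inv in auto)
  thus "prob (\<Inter>j\<in>J. A j) = (\<Prod>j\<in>J. prob (A j))"
    by (simp add: inv prod.reindex[OF injJ])
qed

subsection \<open>Arrival times of a unit rate Poisson process\<close>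

text \<open>Given the event, arrivals before number \<open>i\<close> are at most
  \<open>t (2*i)\<close> and the others exceed \<open>t (2*i+1)\<close>, which fixes the counts.
  Conversely the counts place the arrivals one after another.\<close>

lemma arrival_event_iff_counts:
  assumes y: "y \<in> arrival_paths" and t: "mono t" "t 0 = (0::real)"
  shows "y \<in> arrival_event n t \<longleftrightarrow>
    (\<forall>i\<le>n. {k. y k \<in> {t (2*i)<..t (2*i+1)}} = {}) \<and>
    (\<forall>i<n. \<exists>k. {k. y k \<in> {t (2*i+1)<..t (2*i+2)}} = {k})"
proof -
  have sm: "strict_mono y" using y by (auto simp: arrival_paths_def strict_mono_Suc_iff)
  have mono: "y i \<le> y j" if "i \<le> j" for i j using sm that by (simp add: strict_mono_less_eq)
  have tm: "t i \<le> t j" if "i \<le> j" for i j using t that by (auto dest: monoD)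
  show ?thesis
  proof (intro iffI conjI allI impI)
    assume ev: "y \<in> arrival_event n t"
    have lo: "t (2*i+1) < y i" if "i \<le> n" for i
      using ev that by (cases "i = n") (auto simp: arrival_event_def)
    have hi: "y i \<le> t (2*i+2)" if "i < n" for i
      using ev that by (auto simp: arrival_event_def)
    have lo': "t (2*i+1) < y k" if "i \<le> n" "i \<le> k" for i k
      using lo[OF that(1)] mono[OF that(2)] by simp
    have hi': "y k \<le> t (2*i)" if "i \<le> n" "k < i" for i k
      using hi[of k] tm[of "2*k+2" "2*i"] that by auto
    show "{k. y k \<in> {t (2*i)<..t (2*i+1)}} = {}" if "i \<le> n" for i
    proof -
      have "y k \<notin> {t (2*i)<..t (2*i+1)}" for k
        using lo'[OF that, of k] hi'[OF that, of k] by (cases "k < i") auto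
      thus ?thesis by simp
    qed
    show "\<exists>k. {k. y k \<in> {t (2*i+1)<..t (2*i+2)}} = {k}" if "i < n" for i
    proof (intro exI[of _ i] set_eqI iffI)
      fix k assume k: "k \<in> {k. y k \<in> {t (2*i+1)<..t (2*i+2)}}"
      have "\<not> k < i"
        using hi'[of i k] that k tm[of "2*i" "2*i+1"] by auto
      moreover have "\<not> i < k"
        using lo'[of "Suc i" k] that k tm[of "2*i+2" "2*i+3"] by (auto simp: numeral_3_eq_3)
      ultimately show "k \<in> {i}" by simp
    next
      fix k assume "k \<in> {i}"
      thus "k \<in> {k. y k \<in> {t (2*i+1)<..t (2*i+2)}}" using lo[of i] hi[of i] that by simp
    qed
  next
    assume "(\<forall>i\<le>n. {k. y k \<in> {t (2*i)<..t (2*i+1)}} = {}) \<and>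
      (\<forall>i<n. \<exists>k. {k. y k \<in> {t (2*i+1)<..t (2*i+2)}} = {k})"
    hence none: "\<And>i k. i \<le> n \<Longrightarrow> t (2*i) < y k \<Longrightarrow> t (2*i+1) < y k"
      and one: "\<And>i. i < n \<Longrightarrow> \<exists>k. {k. y k \<in> {t (2*i+1)<..t (2*i+2)}} = {k}"
      by (auto simp: not_le)
    \<comment> \<open>The invariant also locates arrival \<open>i\<close> after
      \<open>t (2*i)\<close>: the empty cell pushes it past \<open>t (2*i+1)\<close>, the next cell
      must then hold it, and being alone there it forces its successor beyond.\<close>
    have "(\<forall>k<i. t (2*k+1) < y k \<and> y k \<le> t (2*k+2)) \<and> t (2*i) < y i" if "i \<le> n" for i
      using that
    proof (induction i)
      case 0
      show ?case using y t by (simp add: arrival_paths_def)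
    next
      case (Suc i)
      hence IH: "\<And>k. k < i \<Longrightarrow> t (2*k+1) < y k \<and> y k \<le> t (2*k+2)" "t (2*i) < y i" by auto
      have lo: "t (2*i+1) < y i" using none[of i i] IH(2) Suc.prems by simp
      obtain k where k: "{k. y k \<in> {t (2*i+1)<..t (2*i+2)}} = {k}"
        using one[of i] Suc.prems by auto
      hence yk: "t (2*i+1) < y k" "y k \<le> t (2*i+2)" by auto
      have "\<not> k < i"
        using IH(1)[of k] yk(1) tm[of "2*k+2" "2*i+1"] by auto
      hence hi: "y i \<le> t (2*i+2)" using mono[of i k] yk(2) by simp
      have "t (2*i+2) < y (Suc i)"
      proof (rule ccontr)
        assume "\<not> ?thesis"
        moreover have "y i < y (Suc i)" using y by (simp add: arrival_paths_def)
        ultimately have "{i, Suc i} \<subseteq> {k. y k \<in> {t (2*i+1)<..t (2*i+2)}}" using lo by auto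
        thus False unfolding k by auto
      qed
      thus ?case using IH(1) lo hi by (auto simp: less_Suc_eq)
    qed
    from this[of n] none[of n n] show "y \<in> arrival_event n t"
      by (simp add: arrival_event_def)
  qed
qed

text \<open>The product of the Poisson probabilities of counts 0, 1, 0, and so on: the exponents
  telescope, and only the cells with count 1 contribute their lengths.\<close>

lemma prod_alternating_poisson:
  fixes t :: "nat \<Rightarrow> real"
  shows "(\<Prod>j\<le>2*n. exp (- (t (Suc j) - t j)) * (t (Suc j) - t j) ^ (j mod 2) / fact (j mod 2))
    = exp (- (t (2*n+1) - t 0)) * (\<Prod>i<n. t (2*i+2) - t (2*i+1))"
proof (induction n)
  case (Suc n)
  let ?f = "\<lambda>j. exp (- (t (Suc j) - t j)) * (t (Suc j) - t j) ^ (j mod 2) / fact (j mod 2)"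
  let ?p = "\<Prod>i<n. t (2*i+2) - t (2*i+1)"
  let ?a = "t (2*n+1)" and ?b = "t (2*n+2)" and ?c = "t (2*n+3)"
  have "(\<Prod>j\<le>2 * Suc n. ?f j) = (\<Prod>j\<le>2*n. ?f j) * ?f (2*n+1) * ?f (2*n+2)"
    by simp
  also have "?f (2*n+1) = exp (- (?b - ?a)) * (?b - ?a)"
    by (simp add: mod_Suc)
  also have "?f (2*n+2) = exp (- (?c - ?b))"
    by (simp add: mod_Suc numeral_3_eq_3)
  also have "(\<Prod>j\<le>2*n. ?f j) * (exp (- (?b - ?a)) * (?b - ?a)) * exp (- (?c - ?b))
      = exp (- (?a - t 0)) * exp (- (?b - ?a)) * exp (- (?c - ?b)) * (?p * (?b - ?a))"
    unfolding Suc.IH by (simp only: ac_simps)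
  also have "exp (- (?a - t 0)) * exp (- (?b - ?a)) * exp (- (?c - ?b)) = exp (- (?c - t 0))"
    by (simp add: exp_add[symmetric])
  finally show ?case by (simp add: numeral_3_eq_3)
qed simp

text \<open>On \<open>arrival_paths\<close>, hence almost surely, the event prescribes the counts in
  finitely many disjoint cells, which are independent Poisson variables.\<close>

lemma poisson_process_arrival_event:
  assumes "prob_space M" and S [measurable]: "\<And>k::nat. S k \<in> borel_measurable M"
    and paths: "AE \<omega> in M. (\<lambda>k. S k \<omega>) \<in> arrival_paths"
    and pp: "poisson_process M \<mu> (\<lambda>\<omega>. distr (count_space UNIV) borel (\<lambda>k. S k \<omega>))"
    and \<mu>: "sets \<mu> = sets borel" "\<And>c d. 0 \<le> c \<Longrightarrow> c \<le> d \<Longrightarrow> emeasure \<mu> {c<..d} = ennreal (d - c)"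
    and grid: "arrival_grid n \<tau>"
  shows "emeasure M {\<omega> \<in> space M. (\<lambda>k. S k \<omega>) \<in> arrival_event n \<tau>}
    = ennreal (exp (- \<tau> (2*n+1)) * (\<Prod>i<n. \<tau> (2*i+2) - \<tau> (2*i+1)))"
proof -
  interpret prob_space M by fact
  \<comment> \<open>The constant extension is monotone on all indices, so the cells form the
    infinite disjoint family that \<open>poisson_process\<close> asks for, padded with empty
    cells.\<close>
  define t where "t j = \<tau> (min j (2*n+1))" for j
  have t: "mono t" "t 0 = 0"
  proof -
    show "mono t"
    proof (rule mono_iff_le_Suc[THEN iffD2], rule allI)
      fix j
      show "t j \<le> t (Suc j)"
      proof (cases "j \<le> 2*n")
        case True
        thus ?thesis using grid by (simp add: t_def arrival_grid_def)
      qed (simp add: t_def)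
    qed
    show "t 0 = 0" using grid by (simp add: t_def arrival_grid_def)
  qed
  have t_eq: "t j = \<tau> j" if "j \<le> 2*n+1" for j using that by (simp add: t_def)
  have ev_t: "arrival_event n \<tau> = arrival_event n t"
    unfolding arrival_event_def by (intro Collect_cong) (auto simp: t_eq)
  have tm: "t i \<le> t j" if "i \<le> j" for i j using t that by (auto dest: monoD)
  have t0: "0 \<le> t j" for j using tm[of 0 j] t by simp
  define A where "A j = {t j<..t (Suc j)}" for j
  define C where "C j \<omega> = emeasure (distr (count_space UNIV) borel (\<lambda>k. S k \<omega>)) (A j)" for j \<omega>
  have C: "C j \<omega> = emeasure (count_space UNIV) {k. S k \<omega> \<in> A j}" for j \<omega>
    unfolding C_def by (subst emeasure_distr) (auto simp: A_def vimage_def)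
  have disj: "disjoint_family A"
  proof -
    have "A i \<inter> A j = {}" if "i < j" for i j
      using tm[of "Suc i" j] that by (auto simp: A_def)
    thus ?thesis unfolding disjoint_family_on_def by (metis Int_commute linorder_neqE_nat)
  qed
  have ind: "indep_vars (\<lambda>_. borel) C UNIV"
    unfolding C_def
    by (rule conjunct2[OF pp[unfolded poisson_process_def], rule_format, OF _ disj])
      (auto simp: A_def \<mu>(1))
  have Cm [measurable]: "C j \<in> borel_measurable M" for j
    using ind by (simp add: indep_vars_def)
  have pC: "prob {\<omega> \<in> space M. C j \<omega> = of_nat m} = exp (- (t (Suc j) - t j)) * (t (Suc j) - t j) ^ m / fact m" for j m
  proof -
    have "poisson_distributed M (C j) (emeasure \<mu> (A j))"
      unfolding C_def
      by (rule conjunct1[OF pp[unfolded poisson_process_def], rule_format]) (simp add: A_def \<mu>(1))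
    also have "emeasure \<mu> (A j) = ennreal (t (Suc j) - t j)"
      using t0[of j] tm[of j "Suc j"] by (simp add: A_def \<mu>(2))
    finally have "poisson_distributed M (C j) (ennreal (t (Suc j) - t j))" .
    thus ?thesis using tm[of j "Suc j"] by (simp add: poisson_distributed_def)
  qed
  have ev: "(\<lambda>k. S k \<omega>) \<in> arrival_event n \<tau> \<longleftrightarrow> (\<forall>j\<in>{..2*n}. C j \<omega> = of_nat (j mod 2))"
    if "(\<lambda>k. S k \<omega>) \<in> arrival_paths" for \<omega>
  proof -
    have one: "emeasure (count_space UNIV) X = 1 \<longleftrightarrow> (\<exists>k. X = {k})" for X :: "nat set"
    proof (cases "finite X")
      case True
      hence "emeasure (count_space UNIV) X = 1 \<longleftrightarrow> card X = 1"
        by (simp add: emeasure_count_space)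
      thus ?thesis by (simp add: card_1_singleton_iff)
    next
      case False
      hence "emeasure (count_space UNIV) X \<noteq> 1" by (simp add: emeasure_count_space)
      moreover have "X \<noteq> {k}" for k using False by auto
      ultimately show ?thesis by blast
    qed
    have even: "C (2*i) \<omega> = of_nat ((2*i) mod 2) \<longleftrightarrow> {k. S k \<omega> \<in> {t (2*i)<..t (2*i+1)}} = {}" for i
      unfolding C A_def by (simp add: emeasure_count_space_eq_0)
    have odd: "C (2*i+1) \<omega> = of_nat ((2*i+1) mod 2) \<longleftrightarrow> (\<exists>k. {k. S k \<omega> \<in> {t (2*i+1)<..t (2*i+2)}} = {k})" for i
      unfolding C A_def one[symmetric] by simp
    have split: "(\<forall>j\<in>{..2*n}. P j) \<longleftrightarrow> (\<forall>i\<le>n. P (2*i)) \<and> (\<forall>i<n. P (2*i+1))" for P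
    proof (intro iffI ballI)
      fix j assume P: "(\<forall>i\<le>n. P (2*i)) \<and> (\<forall>i<n. P (2*i+1))" and j: "j \<in> {..2*n}"
      show "P j"
      proof (cases "even j")
        case True
        then obtain i where "j = 2*i" by (auto elim: evenE)
        thus ?thesis using P j by auto
      next
        case False
        then obtain i where i: "j = 2*i+1" by (auto elim: oddE)
        hence "i < n" using j by auto
        thus ?thesis using P by (simp add: i)
      qed
    qed auto
    show ?thesis
      unfolding ev_t arrival_event_iff_counts[OF that t] split[of "\<lambda>j. C j \<omega> = of_nat (j mod 2)"] even odd ..
  qed
  have "emeasure M {\<omega> \<in> space M. (\<lambda>k. S k \<omega>) \<in> arrival_event n \<tau>}
      = emeasure M (\<Inter>j\<in>{..2*n}. C j -` {of_nat (j mod 2)} \<inter> space M)"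
  proof (rule emeasure_eq_AE)
    show "AE \<omega> in M. \<omega> \<in> {\<omega> \<in> space M. (\<lambda>k. S k \<omega>) \<in> arrival_event n \<tau>} \<longleftrightarrow>
        \<omega> \<in> (\<Inter>j\<in>{..2*n}. C j -` {of_nat (j mod 2)} \<inter> space M)"
      using paths AE_space by eventually_elim (use ev in auto)
    have "(\<lambda>\<omega>. \<lambda>k. S k \<omega>) \<in> M \<rightarrow>\<^sub>M seq_space"
      by (intro measurable_PiM_single') auto
    thus "{\<omega> \<in> space M. (\<lambda>k. S k \<omega>) \<in> arrival_event n \<tau>} \<in> sets M" by measurable
    show "(\<Inter>j\<in>{..2*n}. C j -` {of_nat (j mod 2)} \<inter> space M) \<in> sets M"
      by (intro sets.finite_INT measurable_sets[OF Cm]) auto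
  qed
  also have "\<dots> = ennreal (\<Prod>j\<le>2*n. prob (C j -` {of_nat (j mod 2)} \<inter> space M))"
    unfolding emeasure_eq_measure by (subst indep_varsD[OF ind]) auto
  also have "(\<Prod>j\<le>2*n. prob (C j -` {of_nat (j mod 2)} \<inter> space M))
      = (\<Prod>j\<le>2*n. exp (- (t (Suc j) - t j)) * (t (Suc j) - t j) ^ (j mod 2) / fact (j mod 2))"
    unfolding pC[symmetric] by (intro prod.cong arg_cong[where f = prob]) auto
  also have "\<dots> = exp (- \<tau> (2*n+1)) * (\<Prod>i<n. \<tau> (2*i+2) - \<tau> (2*i+1))"
    unfolding prod_alternating_poisson using t by (simp add: t_eq)
  finally show ?thesis .
qed

text \<open>The mapping theorem: counts of the image process are counts in preimages, and preimages
  of disjoint sets are disjoint.\<close>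

lemma poisson_process_distr:
  assumes pp: "poisson_process M \<mu> N" and g: "g \<in> \<mu> \<rightarrow>\<^sub>M T"
    and sN: "\<And>\<omega>. sets (N \<omega>) = sets \<mu>"
  shows "poisson_process M (distr \<mu> T g) (\<lambda>\<omega>. distr (N \<omega>) T g)"
proof -
  have em: "emeasure (distr (N \<omega>) T g) B = emeasure (N \<omega>) (g -` B \<inter> space \<mu>)" if "B \<in> sets T" for \<omega> B
    using g sN[of \<omega>] that sets_eq_imp_space_eq[OF sN[of \<omega>]]
    by (subst emeasure_distr) (auto cong: measurable_cong_sets)
  show ?thesis
    unfolding poisson_process_def
  proof (intro conjI ballI allI impI)
    fix B assume "B \<in> sets (distr \<mu> T g)"
    thus "poisson_distributed M (\<lambda>\<omega>. emeasure (distr (N \<omega>) T g) B) (emeasure (distr \<mu> T g) B)"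
      using pp g by (simp add: em emeasure_distr poisson_process_def measurable_sets)
  next
    fix A :: "nat \<Rightarrow> _" assume A: "range A \<subseteq> sets (distr \<mu> T g)" "disjoint_family A"
    have "range (\<lambda>n. g -` A n \<inter> space \<mu>) \<subseteq> sets \<mu>" using A g by (auto intro: measurable_sets)
    moreover have "disjoint_family (\<lambda>n. g -` A n \<inter> space \<mu>)"
      using A(2) by (auto simp: disjoint_family_on_def)
    ultimately have "prob_space.indep_vars M (\<lambda>_. borel) (\<lambda>n \<omega>. emeasure (N \<omega>) (g -` A n \<inter> space \<mu>)) UNIV"
      using pp by (simp add: poisson_process_def)
    moreover have "emeasure (distr (N \<omega>) T g) (A n) = emeasure (N \<omega>) (g -` A n \<inter> space \<mu>)" for n \<omega>
      using A(1) by (intro em) auto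
    ultimately show "prob_space.indep_vars M (\<lambda>_. borel) (\<lambda>n \<omega>. emeasure (distr (N \<omega>) T g) (A n)) UNIV"
      by simp
  qed
qed

text \<open>At rate 0 the Poisson formula for \<open>n = 0\<close> gives
  \<open>0 ^ 0 / fact 0 = 1\<close>, so the count vanishes with probability one.\<close>

lemma poisson_process_AE_none:
  assumes "prob_space M" and pp: "poisson_process M \<mu> N" and B: "B \<in> sets \<mu>" "emeasure \<mu> B = 0"
  shows "AE \<omega> in M. emeasure (N \<omega>) B = 0"
proof -
  interpret prob_space M by fact
  have pd: "poisson_distributed M (\<lambda>\<omega>. emeasure (N \<omega>) B) 0"
    using pp B by (auto simp: poisson_process_def)
  hence [measurable]: "(\<lambda>\<omega>. emeasure (N \<omega>) B) \<in> borel_measurable M"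
    by (simp add: poisson_distributed_def)
  have "\<forall>n::nat. prob {\<omega> \<in> space M. emeasure (N \<omega>) B = of_nat n} = 0 ^ n / fact n"
    using pd by (simp add: poisson_distributed_def)
  from spec[OF this, of 0] have "prob {\<omega> \<in> space M. emeasure (N \<omega>) B = 0} = 1" by simp
  thus ?thesis by (subst (asm) prob_Collect_eq_1) auto
qed

subsection \<open>Jumps of the truncated subordinator\<close>

lemma emeasure_levy_measure_truncated:
  assumes lam: "continuous_levy_density lam" and "B \<in> sets borel"
  shows "emeasure (levy_measure (truncated_density lam a)) B
    = (\<integral>\<^sup>+s. ennreal (indicator {0<..a} s * lam s) * indicator B s \<partial>lborel)"
proof -
  have eq: "ennreal (truncated_density lam a s) * indicator {0<..} s = ennreal (indicator {0<..a} s * lam s)" for s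
    by (auto simp: truncated_density_def split: split_indicator)
  have "(\<lambda>s. ennreal (indicator {..a} s * (indicator {0<..} s * lam s))) \<in> borel_measurable borel"
    using levy_density_measurable[OF lam] by measurable
  also have "(\<lambda>s. ennreal (indicator {..a} s * (indicator {0<..} s * lam s)))
      = (\<lambda>s. ennreal (indicator {0<..a} s * lam s))"
    by (auto split: split_indicator)
  finally show ?thesis
    using \<open>B \<in> sets borel\<close> unfolding levy_measure_def eq by (subst emeasure_density) auto
qed

text \<open>The interval is closed on the left because the decreasing change of coordinate turns
  windows \<open>{c<..d}\<close> into such intervals; the endpoints are Lebesgue null.\<close>

lemma emeasure_levy_measure_truncated_Ico:
  assumes lam: "continuous_levy_density lam" and rs: "0 < r" "r \<le> s" "s \<le> a"
  shows "emeasure (levy_measure (truncated_density lam a)) {r..<s}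
    = ennreal (levy_tail lam r - levy_tail lam s)"
proof -
  have i: "set_integrable lborel {r<..s} lam"
    by (rule set_integrable_subset[OF levy_density_set_integrable[OF lam \<open>0 < r\<close>]]) auto
  have "emeasure (levy_measure (truncated_density lam a)) {r..<s}
      = (\<integral>\<^sup>+u. ennreal (indicator {0<..a} u * lam u) * indicator {r..<s} u \<partial>lborel)"
    by (rule emeasure_levy_measure_truncated[OF lam]) simp
  also have "\<dots> = (\<integral>\<^sup>+u. ennreal (indicator {r<..s} u *\<^sub>R lam u) \<partial>lborel)"
  proof (rule nn_integral_cong_AE)
    show "AE u in lborel. ennreal (indicator {0<..a} u * lam u) * indicator {r..<s} u
        = ennreal (indicator {r<..s} u *\<^sub>R lam u)"
      using AE_lborel_singleton[of r] AE_lborel_singleton[of s]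
      by eventually_elim (use rs in \<open>auto split: split_indicator\<close>)
  qed
  also have "\<dots> = ennreal (LBINT u:{r<..s}. lam u)"
    unfolding set_lebesgue_integral_def using i lam rs
    by (intro nn_integral_eq_integral)
       (auto simp: set_integrable_def continuous_levy_density_def split: split_indicator)
  finally show ?thesis using levy_tail_diff(1)[OF lam rs(1,2)] by simp
qed

text \<open>The value 0 off the positive half line makes the map measurable everywhere and keeps
  those points out of every window \<open>{c<..d}\<close> with \<open>0 \<le> c\<close>.\<close>

definition tail_coordinate :: "(real \<Rightarrow> real) \<Rightarrow> real \<Rightarrow> real \<Rightarrow> real" where
  "tail_coordinate lam a x = indicator {0<..} x * (levy_tail lam x - levy_tail lam a)"

lemma borel_measurable_tail_coordinate:
  assumes "continuous_levy_density lam"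
  shows "tail_coordinate lam a \<in> borel_measurable borel"
proof -
  have "continuous_on {0<..} (\<lambda>x. levy_tail lam x - levy_tail lam a)"
    using isCont_levy_tail[OF assms]
    by (intro continuous_intros continuous_at_imp_continuous_on) auto
  from borel_measurable_continuous_on_indicator[OF _ this] show ?thesis
    by (simp add: tail_coordinate_def[abs_def])
qed

text \<open>The new coordinate has unit rate. By \<open>levy_tail_inverse_le_iff\<close> the window
  pulls back to \<open>{?r d..<?r c}\<close>, even where the tail is flat, and its mass is a
  difference of tails.\<close>

lemma emeasure_tail_coordinate_image:
  assumes lam: "continuous_levy_density lam" and "0 < a" and cd: "0 \<le> c" "c \<le> d"
  shows "emeasure (distr (levy_measure (truncated_density lam a)) borel (tail_coordinate lam a)) {c<..d}
    = ennreal (d - c)"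
proof -
  let ?r = "\<lambda>c. levy_tail_inverse lam (levy_tail lam a + c)"
  have ge: "levy_tail lam a \<le> levy_tail lam a + c" "levy_tail lam a \<le> levy_tail lam a + d"
    using cd by auto
  have sl: "sets (levy_measure (truncated_density lam a)) = sets borel" by (simp add: levy_measure_def)
  have "tail_coordinate lam a -` {c<..d} \<inter> space (levy_measure (truncated_density lam a)) = {?r d..<?r c}"
  proof -
    have "x \<in> tail_coordinate lam a -` {c<..d} \<longleftrightarrow> x \<in> {?r d..<?r c}" for x
    proof (cases "0 < x")
      case True
      thus ?thesis
        using levy_tail_inverse_le_iff[OF lam \<open>0 < a\<close> ge(1) True]
          levy_tail_inverse_le_iff[OF lam \<open>0 < a\<close> ge(2) True]
        by (auto simp: tail_coordinate_def)
    next
      case False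
      thus ?thesis
        using levy_tail_inverse_pos[OF lam \<open>0 < a\<close> ge(2)] cd by (auto simp: tail_coordinate_def)
    qed
    thus ?thesis using sets_eq_imp_space_eq[OF sl] by auto
  qed
  hence "emeasure (distr (levy_measure (truncated_density lam a)) borel (tail_coordinate lam a)) {c<..d}
      = emeasure (levy_measure (truncated_density lam a)) {?r d..<?r c}"
    using borel_measurable_tail_coordinate[OF lam] sl
    by (subst emeasure_distr) (auto cong: measurable_cong_sets)
  also have "\<dots> = ennreal (levy_tail lam (?r d) - levy_tail lam (?r c))"
  proof (rule emeasure_levy_measure_truncated_Ico[OF lam])
    show "0 < ?r d" by (rule levy_tail_inverse_pos[OF lam \<open>0 < a\<close> ge(2)])
    show "?r c \<le> a" using levy_tail_inverse_le_iff[OF lam \<open>0 < a\<close> ge(1) \<open>0 < a\<close>] cd by simp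
    have "0 < ?r c" by (rule levy_tail_inverse_pos[OF lam \<open>0 < a\<close> ge(1)])
    thus "?r d \<le> ?r c"
      using levy_tail_inverse_le_iff[OF lam \<open>0 < a\<close> ge(2), of "?r c"] cd
        levy_tail_levy_tail_inverse[OF lam \<open>0 < a\<close> ge(1)] by simp
  qed
  also have "\<dots> = ennreal (d - c)"
    using levy_tail_levy_tail_inverse[OF lam \<open>0 < a\<close> ge(1)]
      levy_tail_levy_tail_inverse[OF lam \<open>0 < a\<close> ge(2)] by simp
  finally show ?thesis .
qed

text \<open>The set \<open>B\<close> of excluded positions is null for the truncated Levy measure:
  its density vanishes there, except possibly at the single point \<open>a\<close>. So the Poisson
  process has no point in \<open>B\<close>.\<close>

lemma ranked_jumps_truncated_AE:
  assumes lam: "continuous_levy_density lam" and rj: "ranked_jumps M I (truncated_density lam a) X"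
  shows "AE \<omega> in M. \<forall>k\<in>I. 0 < X k \<omega> \<and> X k \<omega> < a \<and> lam (X k \<omega>) \<noteq> 0"
proof -
  define B where "B = {x. \<not> (x < a \<and> indicator {0<..} x * lam x \<noteq> 0)}"
  have sl: "sets (levy_measure (truncated_density lam a)) = sets borel" by (simp add: levy_measure_def)
  have M: "prob_space M" and pos: "AE \<omega> in M. \<forall>k\<in>I. 0 < X k \<omega>"
    and pp: "poisson_process M (levy_measure (truncated_density lam a)) (\<lambda>\<omega>. distr (count_space I) borel (\<lambda>k. X k \<omega>))"
    using rj by (auto simp: ranked_jumps_def)
  have Bs: "B \<in> sets borel"
  proof -
    have "{x \<in> space borel. \<not> (x < a \<and> indicator {0<..} x * lam x \<noteq> 0)} \<in> sets borel"
      using levy_density_measurable[OF lam] by measurable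
    thus ?thesis by (simp add: B_def)
  qed
  have "emeasure (levy_measure (truncated_density lam a)) B
      = (\<integral>\<^sup>+s. ennreal (indicator {0<..a} s * lam s) * indicator B s \<partial>lborel)"
    by (rule emeasure_levy_measure_truncated[OF lam Bs])
  also have "\<dots> = (\<integral>\<^sup>+(s::real). 0 \<partial>lborel)"
  proof (rule nn_integral_cong_AE)
    show "AE s in lborel. ennreal (indicator {0<..a} s * lam s) * indicator B s = 0"
      using AE_lborel_singleton[of a] by eventually_elim (auto simp: B_def split: split_indicator)
  qed
  finally have null: "emeasure (levy_measure (truncated_density lam a)) B = 0" by simp
  have "AE \<omega> in M. emeasure (distr (count_space I) borel (\<lambda>k. X k \<omega>)) B = 0"
    by (rule poisson_process_AE_none[OF M pp _ null]) (simp only: sl Bs)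
  thus ?thesis using pos
  proof eventually_elim
    fix \<omega> assume "emeasure (distr (count_space I) borel (\<lambda>k. X k \<omega>)) B = 0" and pos: "\<forall>k\<in>I. 0 < X k \<omega>"
    hence "{k \<in> I. X k \<omega> \<in> B} = {}"
      using Bs by (subst (asm) emeasure_distr) (auto simp: emeasure_count_space_eq_0)
    hence "X k \<omega> \<notin> B" if "k \<in> I" for k using that by blast
    thus "\<forall>k\<in>I. 0 < X k \<omega> \<and> X k \<omega> < a \<and> lam (X k \<omega>) \<noteq> 0" using pos by (auto simp: B_def)
  qed
qed

text \<open>Jumps avoid \<open>a\<close> and the zeros of \<open>lam\<close>, so their coordinates
  are positive, strictly increasing and invertible; the mapping theorem makes them a unit rate
  Poisson process.\<close>

lemma tail_coordinate_arrival_event: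
  assumes lam: "continuous_levy_density lam" and "0 < a"
    and rj: "ranked_jumps M {2..} (truncated_density lam a) X"
  defines "S \<equiv> \<lambda>k \<omega>. tail_coordinate lam a (X (k + 2) \<omega>)"
  shows "S k \<in> borel_measurable M"
    and "AE \<omega> in M. (\<lambda>k. S k \<omega>) \<in> arrival_paths \<and>
      (\<forall>k\<ge>2. X k \<omega> = levy_tail_inverse lam (levy_tail lam a + S (k - 2) \<omega>))"
    and "arrival_grid n \<tau> \<Longrightarrow> emeasure M {\<omega> \<in> space M. (\<lambda>k. S k \<omega>) \<in> arrival_event n \<tau>}
      = ennreal (exp (- \<tau> (2*n+1)) * (\<Prod>i<n. \<tau> (2*i+2) - \<tau> (2*i+1)))"
proof -
  have M: "prob_space M" and Xm: "\<And>k. 2 \<le> k \<Longrightarrow> X k \<in> borel_measurable M"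
    and dec: "AE \<omega> in M. \<forall>j\<in>{2..}. \<forall>k\<in>{2..}. j < k \<longrightarrow> X k \<omega> < X j \<omega>"
    and pp: "poisson_process M (levy_measure (truncated_density lam a)) (\<lambda>\<omega>. distr (count_space {2..}) borel (\<lambda>k. X k \<omega>))"
    using rj by (auto simp: ranked_jumps_def)
  show Sm: "S k \<in> borel_measurable M" for k
    unfolding S_def
    by (rule measurable_compose[OF Xm borel_measurable_tail_coordinate[OF lam]]) simp
  show paths: "AE \<omega> in M. (\<lambda>k. S k \<omega>) \<in> arrival_paths \<and>
      (\<forall>k\<ge>2. X k \<omega> = levy_tail_inverse lam (levy_tail lam a + S (k - 2) \<omega>))"
    using ranked_jumps_truncated_AE[OF lam rj] dec
  proof eventually_elim
    fix \<omega> assume X: "\<forall>k\<in>{2..}. 0 < X k \<omega> \<and> X k \<omega> < a \<and> lam (X k \<omega>) \<noteq> 0"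
      and d: "\<forall>j\<in>{2..}. \<forall>k\<in>{2..}. j < k \<longrightarrow> X k \<omega> < X j \<omega>"
    have S: "S k \<omega> = levy_tail lam (X (k + 2) \<omega>) - levy_tail lam a" for k
      using X by (simp add: S_def tail_coordinate_def)
    have "0 < S 0 \<omega>"
      using levy_tail_strict_antimono[OF lam, of "X 2 \<omega>" a "X 2 \<omega>"] bspec[OF X, of 2]
      by (simp add: S numeral_2_eq_2 less_imp_le)
    moreover have "S i \<omega> < S (Suc i) \<omega>" for i
      using levy_tail_strict_antimono[OF lam, of "X (i + 3) \<omega>" "X (i + 2) \<omega>" "X (i + 3) \<omega>"]
        bspec[OF X, of "i + 3"] bspec[OF bspec[OF d, of "i + 2"], of "i + 3"]
      by (simp add: S numeral_3_eq_3 less_imp_le)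
    moreover have "X k \<omega> = levy_tail_inverse lam (levy_tail lam a + S (k - 2) \<omega>)" if "2 \<le> k" for k
      using levy_tail_inverse_levy_tail[OF lam, of "X k \<omega>"] S[of "k - 2"] X that by (simp del: add_2_eq_Suc')
    ultimately show "(\<lambda>k. S k \<omega>) \<in> arrival_paths \<and>
        (\<forall>k\<ge>2. X k \<omega> = levy_tail_inverse lam (levy_tail lam a + S (k - 2) \<omega>))"
      by (simp add: arrival_paths_def)
  qed
  assume grid: "arrival_grid n \<tau>"
  let ?g = "tail_coordinate lam a" and ?\<nu> = "levy_measure (truncated_density lam a)"
  have g: "?g \<in> borel_measurable borel" by (rule borel_measurable_tail_coordinate[OF lam])
  have "distr (distr (count_space {2..}) borel (\<lambda>k. X k \<omega>)) borel ?g
      = distr (count_space UNIV) borel (\<lambda>k. S k \<omega>)" for \<omega>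
  proof -
    \<comment> \<open>Jumps are numbered from 2 and arrivals from 0, so the counting measure is
      transported along the shift.\<close>
    have "bij_betw (\<lambda>k::nat. k + 2) UNIV {2..}"
      by (intro bij_betwI[where g = "\<lambda>k. k - 2"]) auto
    hence "distr (distr (count_space {2..}) borel (\<lambda>k. X k \<omega>)) borel ?g
        = distr (distr (distr (count_space UNIV) (count_space {2..}) (\<lambda>k. k + 2)) borel (\<lambda>k. X k \<omega>)) borel ?g"
      by (simp add: distr_bij_count_space)
    also have "\<dots> = distr (count_space UNIV) borel (\<lambda>k. S k \<omega>)"
      using g by (simp add: distr_distr S_def comp_def)
    finally show ?thesis .
  qed
  moreover have "poisson_process M (distr ?\<nu> borel ?g) (\<lambda>\<omega>. distr (distr (count_space {2..}) borel (\<lambda>k. X k \<omega>)) borel ?g)"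
    using g by (intro poisson_process_distr[OF pp]) (auto simp: levy_measure_def)
  ultimately have pp': "poisson_process M (distr ?\<nu> borel ?g) (\<lambda>\<omega>. distr (count_space UNIV) borel (\<lambda>k. S k \<omega>))"
    by simp
  show "emeasure M {\<omega> \<in> space M. (\<lambda>k. S k \<omega>) \<in> arrival_event n \<tau>}
      = ennreal (exp (- \<tau> (2*n+1)) * (\<Prod>i<n. \<tau> (2*i+2) - \<tau> (2*i+1)))"
    using paths by (intro poisson_process_arrival_event[OF M Sm _ pp' _ _ grid]
        emeasure_tail_coordinate_image[OF lam \<open>0 < a\<close>]) auto
qed

section \<open>From the common law of the arrival times back to the jumps\<close>

theorem theorem1p1:
  fixes lam :: "real \<Rightarrow> real"
    and P0 :: "real measure"
    and H :: "'u measure"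
    and M :: "'w measure" and \<Delta> :: "nat \<Rightarrow> 'w \<Rightarrow> real" and U :: "nat \<Rightarrow> 'w \<Rightarrow> 'u"
    and xi :: "'w \<Rightarrow> 'u measure"
    and K :: "real \<Rightarrow> (nat \<Rightarrow> real) measure"
    and M0 :: "'v measure" and D0 :: "'v \<Rightarrow> real" and D :: "nat \<Rightarrow> 'v \<Rightarrow> real"
    and U0 :: "nat \<Rightarrow> 'v \<Rightarrow> 'u" and xi0 :: "'v \<Rightarrow> 'u measure"
    and N :: "'e measure" and E :: "nat \<Rightarrow> 'e \<Rightarrow> real"
    and a :: real
  assumes "continuous_levy_density lam"
    and "ranked_jumps M {1..} lam \<Delta>"
    and "normalized_random_measure M H (\<Delta> 1) \<Delta> U xi"
    and "tail_law_given_first M lam \<Delta> K"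
    and "prob_space P0" and "sets P0 = sets borel" and "AE x in P0. 0 < x"
    and "GD_distributed M0 K P0 H D0 D U0 xi0"
    and "prob_space N"
    and "prob_space.indep_vars N (\<lambda>_. borel) E {1..}"
    and "\<forall>k\<ge>1. distributed N lborel (E k) (exponential_density 1)"
    and "a > 0"
  shows "K a = distr N tail_space (tail_seq (M_seq lam E a))"
proof -
  note lam = \<open>continuous_levy_density lam\<close>
  interpret N: prob_space N by fact
  \<comment> \<open>The version of the conditional law is fixed at every positive value, so the
    jumps are described at this very \<open>a\<close> and not just almost everywhere.\<close>
  have rj: "ranked_jumps (K a) {2..} (truncated_density lam a) (\<lambda>k x. x k)"
    and "K \<in> borel \<rightarrow>\<^sub>M prob_algebra tail_space"
    using \<open>tail_law_given_first M lam \<Delta> K\<close> \<open>a > 0\<close>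
    by (auto simp: tail_law_given_first_def regular_conditional_law_def)
  from measurable_space[OF this(2), of a]
  have sK: "sets (K a) = sets tail_space" and "prob_space (K a)"
    by (auto simp: space_prob_algebra)
  interpret K: prob_space "K a" by fact
  \<comment> \<open>Jumps and waiting times are numbered from 2, arrival times from 0;
    \<open>S\<close> and \<open>G\<close> absorb the shift, and \<open>\<phi>\<close> turns arrival
    times back into jumps.\<close>
  define S where "S x k = tail_coordinate lam a (x (k + 2))" for x :: "nat \<Rightarrow> real" and k :: nat
  define G where "G \<omega> k = (\<Sum>j\<le>k. E (j + 2) \<omega>)" for \<omega> and k :: nat
  define \<phi> where "\<phi> y = (\<lambda>k\<in>{2..}. levy_tail_inverse lam (levy_tail lam a + y (k - 2)))"
    for y :: "nat \<Rightarrow> real"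
  note S = tail_coordinate_arrival_event[OF lam \<open>a > 0\<close> rj, folded S_def]
  have E: "distributed N lborel (E (i + 2)) (exponential_density 1)" for i
    using assms by auto
  have ind: "N.indep_vars (\<lambda>_. borel) (\<lambda>i. E (i + 2)) UNIV"
    by (rule N.indep_vars_reindex[OF _ N.indep_vars_subset[OF assms(10)]]) (auto simp: inj_on_def)
  have Sm: "S \<in> K a \<rightarrow>\<^sub>M seq_space"
    using S(1) by (intro measurable_PiM_single') auto
  have Gm: "G \<in> N \<rightarrow>\<^sub>M seq_space"
    unfolding G_def using distributed_measurable[OF E]
    by (intro measurable_PiM_single' borel_measurable_sum) auto
  have \<phi>m: "\<phi> \<in> seq_space \<rightarrow>\<^sub>M tail_space"
    unfolding \<phi>_def by measurable
  have law: "distr (K a) seq_space S = distr N seq_space G"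
  proof (rule arrival_law_unique)
    show "finite_measure (distr (K a) seq_space S)"
      using Sm by (rule K.finite_measure_distr)
    show "AE y in distr (K a) seq_space S. y \<in> arrival_paths"
      using S(2) Sm by (subst AE_distr_iff) auto
    show "AE y in distr N seq_space G. y \<in> arrival_paths"
      using N.AE_exponential_sums_arrival_paths[of "\<lambda>i. E (i + 2)", OF E] Gm
      by (subst AE_distr_iff) (auto simp: G_def[abs_def])
    fix n \<tau> assume grid: "arrival_grid n \<tau>"
    have "emeasure (distr (K a) seq_space S) (arrival_event n \<tau>)
        = emeasure (K a) {x \<in> space (K a). S x \<in> arrival_event n \<tau>}"
      using Sm by (subst emeasure_distr) (auto simp: vimage_def Int_def conj_commute)
    moreover have "emeasure (distr N seq_space G) (arrival_event n \<tau>)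
        = emeasure N {\<omega> \<in> space N. G \<omega> \<in> arrival_event n \<tau>}"
      using Gm by (subst emeasure_distr) (auto simp: vimage_def Int_def conj_commute)
    ultimately show "emeasure (distr (K a) seq_space S) (arrival_event n \<tau>)
        = emeasure (distr N seq_space G) (arrival_event n \<tau>)"
      using S(3)[OF grid] N.exponential_sums_arrival_event[OF ind E grid] by (simp add: G_def[abs_def])
  qed auto
  \<comment> \<open>Points of \<open>tail_space\<close> are extensional on \<open>{2..}\<close>, so
    recovering the coordinates there recovers the whole function.\<close>
  have id: "AE x in K a. x = \<phi> (S x)"
    using S(2) AE_space
  proof eventually_elim
    fix x assume x: "S x \<in> arrival_paths \<and>
      (\<forall>k\<ge>2. x k = levy_tail_inverse lam (levy_tail lam a + S x (k - 2)))" "x \<in> space (K a)"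
    hence "x \<in> extensional {2..}"
      using sets_eq_imp_space_eq[OF sK] by (auto simp: space_PiM PiE_def)
    with x show "x = \<phi> (S x)"
      by (intro extensionalityI[of _ "{2..}"]) (auto simp: \<phi>_def)
  qed
  have "K a = distr (K a) tail_space (\<lambda>x. x)"
    by (rule distr_id2[OF sK[symmetric], symmetric])
  also have "\<dots> = distr (K a) tail_space (\<lambda>x. \<phi> (S x))"
    using id sK Sm \<phi>m by (intro distr_cong_AE) (auto cong: measurable_cong_sets)
  also have "\<dots> = distr (distr (K a) seq_space S) tail_space \<phi>"
    using Sm \<phi>m by (simp add: distr_distr comp_def)
  also have "\<dots> = distr N tail_space (\<lambda>\<omega>. \<phi> (G \<omega>))"
    unfolding law using Gm \<phi>m by (simp add: distr_distr comp_def)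
  also have "(\<lambda>\<omega>. \<phi> (G \<omega>)) = tail_seq (M_seq lam E a)"
  proof (rule ext)
    fix \<omega>
    have "(\<Sum>j\<le>k - 2. E (j + 2) \<omega>) = (\<Sum>i=2..k. E i \<omega>)" if "2 \<le> k" for k
      using that by (intro sum.reindex_bij_witness[of _ "\<lambda>i. i - 2" "\<lambda>j. j + 2"]) auto
    thus "\<phi> (G \<omega>) = tail_seq (M_seq lam E a) \<omega>"
      by (auto simp: \<phi>_def G_def tail_seq_def M_seq_def restrict_def fun_eq_iff)
  qed
  finally show ?thesis .
qed

end
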